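(* Let $\mathcal{G}_{\rm LQ}$ be the linear-quadratic game described in the context, and suppose that $B=(B_1,\dots,B_N)$ satisfies: for all $i\in I_N$ and $t\in[0,T]$, $B_i(t)$ has full row rank. Then $\mathcal{G}_{\rm LQ}$ is a Markov potential game if and only if for all $i,j\in I_N$, $Q_i=Q_j$, $R_i=R_j$ and $G_i=G_j$.
   Context: The game $\mathcal{G}_{\rm LQ}$. $I_N=\{1,\dots,N\}$, $T>0$, $\mathcal{S}=[0,T]\times\mathbb{R}^{n_x}$, $A_i=\mathbb{R}^{k_i}$, $n_a=\sum_ik_i$, $\pi^{(N)}=\prod_i\pi_i$, where $\pi_i=\{\phi:[0,T]\times\mathbb{R}^{n_x}\to\mathbb{R}^{k_i}\mid\phi(t,x)=K_i(t)x,\ K_i\in C([0,T];\mathbb{R}^{k_i\times n_x})\}$; a profile $\phi$ is identified with $K=(K_i)_{i\in I_N}\in C([0,T];\mathbb{R}^{n_a\times n_x})$. $\mathbb{S}^n$ denotes symmetric $n\times n$ matrices. Coefficients: $A\in C([0,T];\mathbb{R}^{n_x\times n_x})$, $B\in C([0,T];\mathbb{R}^{n_x\times n_a})$ written in block form $B=(B_1,\dots,B_N)$ with $B_\ell\in C([0,T];\mathbb{R}^{n_x\times k_\ell})$, $\sigma\in\mathbb{R}^{n_x\times n_w}$, $Q_i\in C([0,T];\mathbb{S}^{n_x})$, $R_i\in C([0,T];\mathbb{S}^{n_a})$, $G_i\in\mathbb{S}^{n_x}$. $W$ is an $n_w$-dimensional standard Brownian motion. $X^{t,x,\phi}$ solves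 $\mathrm{d}X_s=(A(s)X_s+B(s)K(s)X_s)\mathrm{d}s+\sigma\,\mathrm{d}W_s$, $s\in[t,T]$, $X_t=x$, and $$V_i^\phi(t,x)=\tfrac12\mathbb{E}\left[\int_t^T\Big((X_s^{t,x,\phi})^\top Q_i(s)X_s^{t,x,\phi}+(K(s)X_s^{t,x,\phi})^\top R_i(s)K(s)X_s^{t,x,\phi}\Big)\mathrm{d}s+(X_T^{t,x,\phi})^\top G_iX_T^{t,x,\phi}\right].$$ Markov potential game: there is $\Phi:\mathcal{S}\times\pi^{(N)}\to\mathbb{R}$ such that for every $(t,x)\in\mathcal{S}$, $i\in I_N$, $\phi_i,\phi_i'\in\pi_i$, $\phi_{-i}\in\prod_{j\ne i}\pi_j$, $\Phi(t,x,(\phi_i',\phi_{-i}))-\Phi(t,x,(\phi_i,\phi_{-i}))=V_i^{(\phi_i',\phi_{-i})}(t,x)-V_i^{(\phi_i,\phi_{-i})}(t,x)$. *)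

theory Defs
  imports "HOL-Probability.Probability"
begin

text \<open>
  The action spaces have player-dependent dimensions. The type \<open>'a\<close> indexes the
  coordinates of the joint action space, and \<open>own c\<close> is the player who controls coordinate \<open>c\<close>.
  Player \<open>i\<close> thus has the \<open>k_i = card {c. own c = i}\<close> coordinates of its block, and objects
  that belong to one block are padded with zeros to the full index type \<open>'a\<close>.
\<close>

definition col_block :: "('a::finite \<Rightarrow> 'i) \<Rightarrow> 'i \<Rightarrow> real^'a^'n \<Rightarrow> real^'a^'n" where
  "col_block own i B = (\<chi> r c. if own c = i then B $ r $ c else 0)"

text \<open>The added columns are zero, so this is the rank condition on the \<open>n_x \<times> k_i\<close> block.\<close>

definition full_row_rank :: "real^'a^'n \<Rightarrow> bool" where
  "full_row_rank B \<longleftrightarrow> rank B = CARD('n)"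

definition linear_policies ::
    "('a::finite \<Rightarrow> 'i) \<Rightarrow> real \<Rightarrow> 'i \<Rightarrow> (real \<times> (real^'n) \<Rightarrow> real^'a) set" where
  "linear_policies own T i =
     {restrict (\<lambda>(t, x). K t *v x) ({0..T} \<times> UNIV) | K.
        continuous_on {0..T} K \<and> (\<forall>t\<in>{0..T}. \<forall>c. own c \<noteq> i \<longrightarrow> K t $ c = 0)}"

definition joint_policy ::
    "('a::finite \<Rightarrow> 'i) \<Rightarrow> ('i \<Rightarrow> 's \<Rightarrow> real^'a) \<Rightarrow> 's \<Rightarrow> real^'a" where
  "joint_policy own \<phi> z = (\<chi> c. \<phi> (own c) z $ c)"

definition markov_potential_game ::
    "'s set \<Rightarrow> ('i \<Rightarrow> 'p set) \<Rightarrow> ('i \<Rightarrow> ('i \<Rightarrow> 'p) \<Rightarrow> 's \<Rightarrow> real) \<Rightarrow> bool" where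
  "markov_potential_game S \<pi> V \<longleftrightarrow>
     (\<exists>\<Phi> :: 's \<Rightarrow> ('i \<Rightarrow> 'p) \<Rightarrow> real.
        \<forall>z\<in>S. \<forall>i. \<forall>\<phi>. (\<forall>j. \<phi> j \<in> \<pi> j) \<longrightarrow> (\<forall>p\<in>\<pi> i.
          \<Phi> z (\<phi>(i := p)) - \<Phi> z \<phi> = V i (\<phi>(i := p)) z - V i \<phi> z))"

definition standard_brownian_motion ::
    "'w measure \<Rightarrow> real \<Rightarrow> (real \<Rightarrow> 'w \<Rightarrow> real^'m) \<Rightarrow> bool" where
  "standard_brownian_motion M T W \<longleftrightarrow>
     prob_space M \<and>
     (\<forall>s\<in>{0..T}. W s \<in> borel_measurable M) \<and>
     (AE \<omega> in M. W 0 \<omega> = 0) \<and>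
     (AE \<omega> in M. continuous_on {0..T} (\<lambda>s. W s \<omega>)) \<and>
     (\<forall>s u. 0 \<le> s \<longrightarrow> s < u \<longrightarrow> u \<le> T \<longrightarrow>
        prob_space.indep_vars M (\<lambda>_. borel) (\<lambda>k \<omega>. (W u \<omega> - W s \<omega>) $ k) UNIV \<and>
        (\<forall>k. distributed M lborel (\<lambda>\<omega>. (W u \<omega> - W s \<omega>) $ k)
               (\<lambda>y. ennreal (normal_density 0 (sqrt (u - s)) y)))) \<and>
     (\<forall>(m::nat) \<tau>. (\<forall>j\<le>m. \<tau> j \<in> {0..T}) \<longrightarrow> mono_on {..m} \<tau> \<longrightarrow>
        prob_space.indep_vars M (\<lambda>_. borel) (\<lambda>j \<omega>. W (\<tau> (Suc j)) \<omega> - W (\<tau> j) \<omega>) {..<m})"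

text \<open>The natural filtration, augmented by the null sets of \<open>M\<close>.\<close>

definition brownian_filtration ::
    "'w measure \<Rightarrow> (real \<Rightarrow> 'w \<Rightarrow> real^'m) \<Rightarrow> real \<Rightarrow> 'w measure" where
  "brownian_filtration M W s =
     sigma (space M)
       ((\<Union>u\<in>{0..s}. {W u -` S \<inter> space M | S. S \<in> sets borel}) \<union> null_sets M)"

text \<open>
  \<open>X\<close> is a strong solution on \<open>{t..T}\<close>, started at \<open>x\<close>, of
  \<open>dX = (A X + B \<phi>(s, X)) ds + \<sigma> dW\<close>. Since \<open>\<sigma>\<close> is constant, the
  stochastic integral of \<open>\<sigma>\<close> over \<open>{t..s}\<close> is \<open>\<sigma> (W s - W t)\<close>.
  All paths of \<open>X\<close> are required to be continuous, not just almost all, so that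
  path functionals of \<open>X\<close> are measurable even if \<open>M\<close> is not complete.
\<close>

definition state_process ::
    "'w measure \<Rightarrow> (real \<Rightarrow> 'w \<Rightarrow> real^'m) \<Rightarrow> real \<Rightarrow> (real \<Rightarrow> real^'n^'n) \<Rightarrow>
     (real \<Rightarrow> real^'a^'n) \<Rightarrow> real^'m^'n \<Rightarrow> (real \<times> (real^'n) \<Rightarrow> real^'a) \<Rightarrow> real \<times> (real^'n) \<Rightarrow>
     (real \<Rightarrow> 'w \<Rightarrow> real^'n) \<Rightarrow> bool" where
  "state_process M W T A B \<sigma> \<phi> z X \<longleftrightarrow> (case z of (t, x) \<Rightarrow>
     (\<forall>s\<in>{t..T}. X s \<in> borel_measurable (brownian_filtration M W s)) \<and>
     (\<forall>\<omega>\<in>space M. continuous_on {t..T} (\<lambda>s. X s \<omega>)) \<and>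
     (AE \<omega> in M. \<forall>s\<in>{t..T}.
        X s \<omega> = x + integral {t..s} (\<lambda>r. A r *v X r \<omega> + B r *v \<phi> (r, X r \<omega>))
                + \<sigma> *v (W s \<omega> - W t \<omega>)))"

text \<open>
  State processes are unique up to indistinguishability for linear \<open>\<phi>\<close>, so the
  value below does not depend on the choice of \<open>X\<close>.
\<close>

definition lq_value ::
    "'w measure \<Rightarrow> (real \<Rightarrow> 'w \<Rightarrow> real^'m) \<Rightarrow> real \<Rightarrow> ('a::finite \<Rightarrow> 'i) \<Rightarrow>
     (real \<Rightarrow> real^'n^'n) \<Rightarrow> (real \<Rightarrow> real^'a^'n) \<Rightarrow> real^'m^'n \<Rightarrow>
     ('i \<Rightarrow> real \<Rightarrow> real^'n^'n) \<Rightarrow> ('i \<Rightarrow> real \<Rightarrow> real^'a^'a) \<Rightarrow> ('i \<Rightarrow> real^'n^'n) \<Rightarrow>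
     'i \<Rightarrow> ('i \<Rightarrow> real \<times> (real^'n) \<Rightarrow> real^'a) \<Rightarrow> real \<times> (real^'n) \<Rightarrow> real" where
  "lq_value M W T own A B \<sigma> Q R G i \<phi> z =
     (let u = joint_policy own \<phi>;
          X = (SOME X. state_process M W T A B \<sigma> u z X)
      in 1 / 2 * (\<integral>\<omega>.
           integral {fst z..T} (\<lambda>s. X s \<omega> \<bullet> (Q i s *v X s \<omega>)
                                   + u (s, X s \<omega>) \<bullet> (R i s *v u (s, X s \<omega>)))
           + X T \<omega> \<bullet> (G i *v X T \<omega>) \<partial>M))"

end

theory Submission
  imports Defs
begin

text \<open>
  If all coefficients agree, all players have the same value function, and this function is a
  potential. The content is the converse.

  \<^bold>\<open>Reduction to a gap of costs.\<close> Fix two players \<open>i \<noteq> j\<close>. If \<open>\<Phi>\<close> is a potential, then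
  \<open>V i - V j = (\<Phi> - V j) - (\<Phi> - V i)\<close>, where the first bracket is independent of the policy
  of \<open>j\<close> and the second of the policy of \<open>i\<close>. So the mixed difference of \<open>V i - V j\<close> in
  the policies of \<open>i\<close> and \<open>j\<close> vanishes (\<open>potential_mixed_difference\<close>). It must follow that
  \<open>Qd = Q i - Q j\<close>, \<open>Rd = R i - R j\<close> and \<open>Gd = G i - G j\<close> are zero.

  \<^bold>\<open>Scalar closed loops.\<close> By the rank condition each player has a continuous right inverse \<open>L\<close>
  of \<open>B\<close> that only uses the player's own rows (\<open>block_right_inverse\<close>), so a single player can
  give the closed-loop matrix \<open>A + B K\<close> any value. Only profiles with
  \<open>A + B K = (h' / h) I\<close> are used, where \<open>h > 0\<close> and \<open>h 0 = 1\<close>. Their state is explicit: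
  \<open>h s x\<close> plus a process that does not depend on the start \<open>x\<close>. The symmetric second
  difference of the value in \<open>x\<close> removes the noise, and what is left is the deterministic cost
  \<open>\<integral> h\<^sup>2 x \<bullet> (Q + K\<^sup>T R K) x + h(T)\<^sup>2 x \<bullet> G x\<close>
  (\<open>lq_value_second_difference\<close>). The probabilistic work is to show that the state process
  exists, is unique up to a null set and has an integrable cost; otherwise the choice operator and
  the integral in the definition of the value would say nothing.

  \<^bold>\<open>One player's late deviations do not change the gap.\<close> Let \<open>j\<close> deviate on \<open>[0, s0]\<close>
  so that the state is multiplied by a factor \<open>a > 1\<close> from then on, and let \<open>i\<close> deviate
  only after \<open>s0\<close>. The mixed difference is then \<open>a\<^sup>2 - 1\<close> times the effect of the
  deviation of \<open>i\<close> alone, so that this effect is zero. If \<open>i\<close> multiplies the state by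
  \<open>1 + \<eta>\<close>, where \<open>\<eta>' = \<phi>\<close>, this effect is a quadratic polynomial in \<open>\<eta>\<close>
  (\<open>deviation_identity\<close>).

  \<^bold>\<open>Extracting the coefficients.\<close> Both homogeneous parts of the polynomial vanish. Since
  \<open>(\<eta>\<^sup>2)' = 2 \<eta> \<phi>\<close>, the linear part for \<open>\<eta>\<^sup>2\<close> cancels all of the
  quadratic part except \<open>\<integral> \<phi>\<^sup>2 (L x) \<bullet> Rd (L x)\<close>; hence \<open>Rd\<close> vanishes as a form on the
  range of \<open>L\<close>. The linear part holds for every base profile \<open>K\<close>, and varying \<open>K\<close> in
  the kernel of \<open>B\<close> shows that \<open>Rd\<close> also vanishes on this kernel and between it and
  the range of \<open>L\<close> (\<open>first_order_expansion\<close>). Since range and kernel are complementary,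
  \<open>Rd = 0\<close>. What remains of the linear part is
  \<open>\<integral> \<eta> (x \<bullet> Qd x) + \<eta>(T) (x \<bullet> Gd x) = 0\<close> for all \<open>\<eta>\<close>, so
  \<open>Qd = 0\<close> and \<open>Gd = 0\<close> (\<open>weak_integral_zero\<close>).
\<close>

section \<open>Continuous families of matrices and quadratic forms\<close>

lemma continuous_on_matrix_vector_mult [continuous_intros]:
  fixes A :: "'s::topological_space \<Rightarrow> real^'n^'m"
  assumes "continuous_on S A" "continuous_on S x"
  shows "continuous_on S (\<lambda>s. A s *v x s)"
  unfolding matrix_vector_mult_def
  by (intro continuous_on_vec_lambda continuous_on_sum continuous_on_mult continuous_on_component assms)

lemma continuous_on_matrix_matrix_mult [continuous_intros]:
  fixes A :: "'s::topological_space \<Rightarrow> real^'n^'m" and B :: "'s \<Rightarrow> real^'k^'n"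
  assumes "continuous_on S A" "continuous_on S B"
  shows "continuous_on S (\<lambda>s. A s ** B s)"
  unfolding matrix_matrix_mult_def
  by (intro continuous_on_vec_lambda continuous_on_sum continuous_on_mult continuous_on_component assms)

lemma continuous_on_transpose [continuous_intros]:
  fixes A :: "'s::topological_space \<Rightarrow> real^'n^'m"
  assumes "continuous_on S A"
  shows "continuous_on S (\<lambda>s. transpose (A s))"
  unfolding transpose_def
  by (intro continuous_on_vec_lambda continuous_on_component assms)

lemma continuous_on_det [continuous_intros]:
  fixes A :: "'s::topological_space \<Rightarrow> real^'n^'n"
  assumes "\<And>i j. continuous_on S (\<lambda>s. A s $ i $ j)"
  shows "continuous_on S (\<lambda>s. det (A s))"
  unfolding det_def
  by (intro continuous_on_sum continuous_on_mult continuous_on_const continuous_on_prod assms)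

lemma inner_matrix_transpose:
  fixes A :: "real^'n^'m"
  shows "x \<bullet> (A *v y) = (transpose A *v x) \<bullet> y"
  by (simp add: dot_lmul_matrix[symmetric])

lemma transpose_diff: "transpose (C - D) = transpose C - transpose D" for C D :: "real^'k^'l"
  by (simp add: transpose_def vec_eq_iff)

lemma symmetric_form_zero:
  fixes P :: "real^'n^'n"
  assumes sym: "transpose P = P" and zero: "\<And>x. x \<bullet> (P *v x) = 0"
  shows "P = 0"
proof -
  have "P *v x = 0" for x
  proof -
    have "y \<bullet> (P *v x) = 0" for y
    proof -
      have "x \<bullet> (P *v y) = y \<bullet> (P *v x)"
        by (metis inner_matrix_transpose sym inner_commute)
      then show ?thesis
        using zero[of "x + y"] zero[of x] zero[of y]
        by (simp add: matrix_vector_right_distrib inner_add_left inner_add_right)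
    qed
    then show ?thesis by (metis inner_eq_zero_iff)
  qed
  then show ?thesis by (simp add: matrix_eq)
qed

lemma matrix_diff_left_distrib: "C ** (D - E) = C ** D - C ** E"
  for C :: "real^'n^'m" and D E :: "real^'k^'n"
  by (simp add: matrix_matrix_mult_def vec_eq_iff algebra_simps sum_subtractf)

lemma matrix_mult_scaleR: "C ** (c *\<^sub>R D) = c *\<^sub>R (C ** D)"
  for C :: "real^'n^'m" and D :: "real^'k^'n"
  by (simp add: matrix_matrix_mult_def vec_eq_iff sum_distrib_left mult_ac)

lemma matrix_through_vector:
  fixes x :: "real^'n" and p :: "real^'a"
  assumes "x \<noteq> 0"
  obtains Y :: "real^'n^'a" where "Y *v x = p"
proof
  have "(\<Sum>c\<in>UNIV. p $ r * x $ c / (x \<bullet> x) * x $ c) = p $ r" for r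
  proof -
    have "(\<Sum>c\<in>UNIV. p $ r * x $ c / (x \<bullet> x) * x $ c) = p $ r / (x \<bullet> x) * (\<Sum>c\<in>UNIV. x $ c * x $ c)"
      by (simp add: sum_distrib_left mult_ac)
    also have "(\<Sum>c\<in>UNIV. x $ c * x $ c) = x \<bullet> x" by (simp add: inner_vec_def)
    finally show ?thesis using assms by simp
  qed
  then show "(\<chi> r c. p $ r * x $ c / (x \<bullet> x)) *v x = p"
    by (simp add: vec_eq_iff matrix_vector_mult_def)
qed

lemma quadratic_form_bound:
  fixes P :: "'s::topological_space \<Rightarrow> real^'n^'n"
  assumes "compact S" "continuous_on S P"
  obtains c where "c \<ge> 0" "\<And>s y. s \<in> S \<Longrightarrow> \<bar>y \<bullet> (P s *v y)\<bar> \<le> c * (norm y)\<^sup>2"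
proof -
  define f where "f s = (\<Sum>i\<in>UNIV. \<Sum>j\<in>UNIV. \<bar>P s $ i $ j\<bar>)" for s
  have "continuous_on S f"
    unfolding f_def by (intro continuous_intros continuous_on_component assms)
  from compact_imp_bounded[OF compact_continuous_image[OF this \<open>compact S\<close>]]
  obtain c where c: "c > 0" "\<And>s. s \<in> S \<Longrightarrow> norm (f s) \<le> c"
    by (auto simp: bounded_pos)
  show ?thesis
  proof
    show "c \<ge> 0" using c by simp
    fix s y assume s: "s \<in> S"
    have "\<bar>y \<bullet> (P s *v y)\<bar> = \<bar>\<Sum>i\<in>UNIV. \<Sum>j\<in>UNIV. y $ i * (P s $ i $ j * y $ j)\<bar>"
      by (simp add: inner_vec_def matrix_vector_mult_def sum_distrib_left)
    also have "\<dots> \<le> (\<Sum>i\<in>UNIV. \<Sum>j\<in>UNIV. \<bar>y $ i * (P s $ i $ j * y $ j)\<bar>)"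
      by (intro order_trans[OF sum_abs] sum_mono) auto
    also have "\<dots> \<le> (\<Sum>i\<in>UNIV. \<Sum>j\<in>UNIV. \<bar>P s $ i $ j\<bar> * (norm y)\<^sup>2)"
    proof (intro sum_mono)
      fix i j :: 'n
      have "\<bar>y $ i * (P s $ i $ j * y $ j)\<bar> = \<bar>P s $ i $ j\<bar> * (\<bar>y $ i\<bar> * \<bar>y $ j\<bar>)"
        by (simp add: abs_mult)
      also have "\<dots> \<le> \<bar>P s $ i $ j\<bar> * (norm y * norm y)"
        by (intro mult_left_mono mult_mono component_le_norm_cart) auto
      finally show "\<bar>y $ i * (P s $ i $ j * y $ j)\<bar> \<le> \<bar>P s $ i $ j\<bar> * (norm y)\<^sup>2"
        by (simp add: power2_eq_square)
    qed
    also have "\<dots> = f s * (norm y)\<^sup>2"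
      by (simp add: f_def sum_distrib_right)
    also have "\<dots> \<le> c * (norm y)\<^sup>2"
      using c(2)[OF s] by (intro mult_right_mono) auto
    finally show "\<bar>y \<bullet> (P s *v y)\<bar> \<le> c * (norm y)\<^sup>2" .
  qed
qed

text \<open>
  Applied with \<open>a\<close> the deterministic and \<open>z\<close> the random part of the state: the second
  difference cancels the mixed terms and the terms in \<open>z\<close> without taking expectations.
\<close>

lemma quadratic_form_parallelogram:
  fixes P :: "real^'n^'n"
  shows "(a + z) \<bullet> (P *v (a + z)) + (- a + z) \<bullet> (P *v (- a + z)) - 2 * (z \<bullet> (P *v z)) = 2 * (a \<bullet> (P *v a))"
  by (simp add: matrix_vector_right_distrib matrix_vector_mult_diff_distrib inner_add_left inner_add_right inner_diff_left inner_diff_right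
      algebra_simps)

text \<open>
  Cramer's rule writes the columns of the inverse as quotients of determinants, and so as
  continuous functions of the matrix entries.
\<close>

lemma continuous_matrix_right_inverse:
  fixes S :: "real \<Rightarrow> real^'n^'n"
  assumes S: "continuous_on X S" and inv: "\<And>s. s \<in> X \<Longrightarrow> invertible (S s)"
  obtains S' where "continuous_on X S'" "\<And>s. s \<in> X \<Longrightarrow> S s ** S' s = mat 1"
proof
  define col where "col s c =
    (\<chi> k. det (\<chi> i j. if j = k then axis c 1 $ i else S s $ i $ j) / det (S s))" for s c
  define S' where "S' s = (\<chi> r c. col s c $ r)" for s
  have det0: "det (S s) \<noteq> 0" if "s \<in> X" for s
    using inv[OF that] by (simp add: invertible_det_nz)
  show "continuous_on X S'"
    unfolding S'_def col_def
  proof (intro continuous_on_vec_lambda)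
    fix r c
    have "continuous_on X (\<lambda>s. det (\<chi> i j. if j = r then axis c 1 $ i else S s $ i $ j) / det (S s))"
    proof (intro continuous_on_divide continuous_on_det ballI)
      show "continuous_on X (\<lambda>s. (\<chi> i j. if j = r then axis c 1 $ i else S s $ i $ j) $ i $ j)" for i j
        by (cases "j = r") (auto intro!: continuous_on_component S)
    qed (auto intro!: continuous_on_component S dest: det0)
    then show "continuous_on X (\<lambda>s. (\<chi> k. det (\<chi> i j. if j = k then axis c 1 $ i else S s $ i $ j) / det (S s)) $ r)"
      by simp
  qed
  fix s assume s: "s \<in> X"
  have col: "S s *v col s c = axis c 1" for c
    using cramer[OF det0[OF s], of "col s c" "axis c 1"] unfolding col_def by blast
  have "(S s ** S' s) $ r $ c = mat 1 $ r $ c" for r c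
  proof -
    have "(S s ** S' s) $ r $ c = (S s *v col s c) $ r"
      by (simp add: matrix_matrix_mult_def matrix_vector_mult_def S'_def)
    also have "\<dots> = mat 1 $ r $ c"
      by (simp add: col axis_def mat_def)
    finally show ?thesis .
  qed
  then show "S s ** S' s = mat 1"
    by (simp add: vec_eq_iff)
qed

text \<open>
  The kernel of \<open>C C\<^sup>T\<close> is that of \<open>C\<^sup>T\<close>, because
  \<open>x \<bullet> C C\<^sup>T x\<close> is the squared length of \<open>C\<^sup>T x\<close>, and full row rank makes
  \<open>C\<^sup>T\<close> injective.
\<close>

lemma gram_invertible:
  fixes C :: "real^'a^'n"
  assumes "full_row_rank C"
  shows "invertible (C ** transpose C)"
proof -
  have inj: "inj ((*v) (transpose C))"
    using assms by (simp add: full_row_rank_def rank_transpose flip: full_rank_injective)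
  have "x = 0" if "(C ** transpose C) *v x = 0" for x
  proof -
    have "(transpose C *v x) \<bullet> (transpose C *v x) = x \<bullet> ((C ** transpose C) *v x)"
      by (simp add: inner_matrix_transpose[of x C] flip: matrix_vector_mul_assoc)
    then have "transpose C *v x = 0" using that by simp
    then show ?thesis using inj by (metis injD matrix_vector_mult_0_right)
  qed
  then show ?thesis
    by (meson invertible_left_inverse matrix_left_invertible_ker)
qed

text \<open>
  For the block \<open>C\<close> of player \<open>i\<close> take \<open>L = C\<^sup>T (C C\<^sup>T)\<^sup>-\<^sup>1\<close>. The zero
  columns that pad \<open>C\<close> become zero rows of \<open>L\<close>, so \<open>L x\<close> is an action of player
  \<open>i\<close> alone, and it is the action that pushes the state in the direction \<open>x\<close>.
\<close>

lemma block_right_inverse: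
  fixes B :: "real \<Rightarrow> real^'a^'n"
  assumes B: "continuous_on X B"
    and rank: "\<And>s. s \<in> X \<Longrightarrow> full_row_rank (col_block own i (B s))"
  obtains L where "continuous_on X L" "\<And>s. s \<in> X \<Longrightarrow> B s ** L s = mat 1"
    "\<And>s c. own c \<noteq> i \<Longrightarrow> L s $ c = 0"
proof -
  let ?C = "\<lambda>s. col_block own i (B s)"
  have "continuous_on X (\<lambda>s. if own c = i then B s $ r $ c else 0)" for r c
    by (cases "own c = i") (auto intro!: continuous_on_component B)
  then have C: "continuous_on X ?C"
    unfolding col_block_def by (intro continuous_on_vec_lambda)
  have "continuous_on X (\<lambda>s. ?C s ** transpose (?C s))"
    by (intro continuous_intros C)
  then obtain S' where S': "continuous_on X S'"
    "\<And>s. s \<in> X \<Longrightarrow> (?C s ** transpose (?C s)) ** S' s = mat 1"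
    using continuous_matrix_right_inverse[of X "\<lambda>s. ?C s ** transpose (?C s)"] gram_invertible[OF rank]
    by blast
  define L where "L s = transpose (?C s) ** S' s" for s
  have rows: "L s $ c = 0" if "own c \<noteq> i" for s c
    using that by (simp add: L_def vec_eq_iff matrix_matrix_mult_def transpose_def col_block_def)
  have "B s ** L s = ?C s ** L s" for s
  proof -
    have "B s $ r $ c * L s $ c $ d = ?C s $ r $ c * L s $ c $ d" for r c d
      using rows[of c s] by (simp add: col_block_def)
    then show ?thesis unfolding matrix_matrix_mult_def by (simp only: cong: sum.cong)
  qed
  then have "B s ** L s = mat 1" if "s \<in> X" for s
    using S'(2)[OF that] by (simp add: L_def matrix_mul_assoc)
  moreover have "continuous_on X L"
    unfolding L_def by (intro continuous_intros C S')
  ultimately show ?thesis using that rows by blast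
qed

section \<open>Linear equations with scalar drift and additive noise\<close>

lemma norm_add_sq_le: "(norm (a + b))\<^sup>2 \<le> 2 * (norm a)\<^sup>2 + 2 * (norm b)\<^sup>2"
  for a b :: "'b::real_normed_vector"
proof -
  have "(norm (a + b))\<^sup>2 \<le> (norm a + norm b)\<^sup>2"
    by (intro power_mono norm_triangle_ineq) auto
  also have "\<dots> \<le> 2 * (norm a)\<^sup>2 + 2 * (norm b)\<^sup>2"
    using sum_squares_bound[of "norm a" "norm b"] by (simp add: power2_sum)
  finally show ?thesis .
qed

text \<open>
  The solution of \<open>X s = \<integral>\<^sub>0\<^sup>s (h' / h) X + w s\<close>, obtained by variation of
  constants. The noise path \<open>w\<close> is only continuous, and integration by parts has removed
  its differential.
\<close>

definition additive_noise_response ::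
    "(real \<Rightarrow> real) \<Rightarrow> (real \<Rightarrow> real) \<Rightarrow> (real \<Rightarrow> 'b) \<Rightarrow> real \<Rightarrow> 'b::euclidean_space" where
  "additive_noise_response h h' w s = w s + h s *\<^sub>R integral {0..s} (\<lambda>r. (h' r / (h r)\<^sup>2) *\<^sub>R w r)"

text \<open>
  Uniqueness: \<open>Y = X - w\<close> is differentiable although \<open>X\<close> is not, and \<open>1 / h\<close> is an
  integrating factor for it, with \<open>(Y / h)' = (h' / h\<^sup>2) w\<close>.
\<close>

lemma scalar_equation_unique:
  fixes X w :: "real \<Rightarrow> 'b::euclidean_space"
  assumes h: "\<And>s. s \<in> {0..T} \<Longrightarrow> (h has_real_derivative h' s) (at s within {0..T})"
    and pos: "\<And>s. s \<in> {0..T} \<Longrightarrow> h s > 0" and h0: "h 0 = 1"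
    and X: "continuous_on {0..T} X" and h': "continuous_on {0..T} h'"
    and eq: "\<And>s. s \<in> {0..T} \<Longrightarrow> X s = x + integral {0..s} (\<lambda>r. (h' r / h r) *\<^sub>R X r) + w s"
    and w0: "w 0 = 0" and s: "s \<in> {0..T}"
  shows "X s = h s *\<^sub>R x + additive_noise_response h h' w s"
proof -
  define Y where "Y u = x + integral {0..u} (\<lambda>r. (h' r / h r) *\<^sub>R X r)" for u
  have hc: "continuous_on {0..T} h"
    using h by (rule DERIV_continuous_on)
  have ne: "h u \<noteq> 0" if "u \<in> {0..T}" for u using pos[OF that] by simp
  have cont: "continuous_on {0..T} (\<lambda>r. (h' r / h r) *\<^sub>R X r)"
    by (intro continuous_intros hc h' X ballI ne)
  have dY: "(Y has_vector_derivative (h' u / h u) *\<^sub>R X u) (at u within {0..T})" if "u \<in> {0..T}" for u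
    unfolding Y_def
    using integral_has_vector_derivative[OF cont that]
    by (auto intro: derivative_eq_intros)
  have dZ: "((\<lambda>u. (1 / h u) *\<^sub>R Y u) has_vector_derivative (h' u / (h u)\<^sup>2) *\<^sub>R w u) (at u within {0..T})"
    if u: "u \<in> {0..T}" for u
  proof -
    have "((\<lambda>u. 1 / h u) has_real_derivative - (h' u / (h u)\<^sup>2)) (at u within {0..T})"
      using h[OF u] ne[OF u] by (auto intro!: derivative_eq_intros simp: power2_eq_square)
    from has_vector_derivative_scaleR[OF this dY[OF u]]
    have "((\<lambda>u. (1 / h u) *\<^sub>R Y u) has_vector_derivative
        (1 / h u) *\<^sub>R (h' u / h u) *\<^sub>R X u + (- (h' u / (h u)\<^sup>2)) *\<^sub>R Y u) (at u within {0..T})" .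
    moreover have "X u = Y u + w u" unfolding Y_def using eq[OF u] by simp
    ultimately show ?thesis
      by (simp add: scaleR_add_right power2_eq_square)
  qed
  have "((\<lambda>r. (h' r / (h r)\<^sup>2) *\<^sub>R w r) has_integral (1 / h s) *\<^sub>R Y s - (1 / h 0) *\<^sub>R Y 0) {0..s}"
    using s by (intro fundamental_theorem_of_calculus)
       (auto intro: has_vector_derivative_within_subset[OF dZ])
  then have "integral {0..s} (\<lambda>r. (h' r / (h r)\<^sup>2) *\<^sub>R w r) = (1 / h s) *\<^sub>R Y s - x"
    by (simp add: integral_unique h0 Y_def)
  then have "Y s = h s *\<^sub>R x + h s *\<^sub>R integral {0..s} (\<lambda>r. (h' r / (h r)\<^sup>2) *\<^sub>R w r)"
    using ne[OF s] by (simp add: scaleR_right_diff_distrib)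
  moreover have "X s = Y s + w s" unfolding Y_def using eq[OF s] by simp
  ultimately show ?thesis by (simp add: additive_noise_response_def)
qed

lemma additive_noise_response_continuous:
  fixes w :: "real \<Rightarrow> 'b::euclidean_space"
  assumes h: "continuous_on {0..T} h" and pos: "\<And>s. s \<in> {0..T} \<Longrightarrow> h s > 0"
    and h': "continuous_on {0..T} h'" and w: "continuous_on {0..T} w"
  shows "continuous_on {0..T} (additive_noise_response h h' w)"
proof -
  have "continuous_on {0..T} (\<lambda>r. (h' r / (h r)\<^sup>2) *\<^sub>R w r)"
    using pos by (intro continuous_intros h h' w) force
  from integrable_continuous_real[OF this] show ?thesis
    unfolding additive_noise_response_def
    by (intro continuous_on_add continuous_on_scaleR h w indefinite_integral_continuous_1)
qed

lemma scalar_equation_existence: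
  fixes x :: "'b::euclidean_space" and w :: "real \<Rightarrow> 'b"
  assumes h: "\<And>s. s \<in> {0..T} \<Longrightarrow> (h has_real_derivative h' s) (at s within {0..T})"
    and pos: "\<And>s. s \<in> {0..T} \<Longrightarrow> h s > 0" and h0: "h 0 = 1"
    and h': "continuous_on {0..T} h'" and w: "continuous_on {0..T} w"
    and s: "s \<in> {0..T}"
  defines "X \<equiv> \<lambda>s. h s *\<^sub>R x + additive_noise_response h h' w s"
  shows "X s = x + integral {0..s} (\<lambda>r. (h' r / h r) *\<^sub>R X r) + w s"
proof -
  define Y where "Y u = h u *\<^sub>R (x + integral {0..u} (\<lambda>r. (h' r / (h r)\<^sup>2) *\<^sub>R w r))" for u
  have hc: "continuous_on {0..T} h"
    using h by (rule DERIV_continuous_on)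
  have ne: "h u \<noteq> 0" if "u \<in> {0..T}" for u using pos[OF that] by simp
  have cont: "continuous_on {0..T} (\<lambda>r. (h' r / (h r)\<^sup>2) *\<^sub>R w r)"
    using ne by (intro continuous_intros hc h' w) force
  have XY: "X u = Y u + w u" for u
    by (simp add: X_def Y_def additive_noise_response_def scaleR_add_right)
  have dY: "(Y has_vector_derivative (h' u / h u) *\<^sub>R X u) (at u within {0..T})" if u: "u \<in> {0..T}" for u
  proof -
    have "((\<lambda>u. x + integral {0..u} (\<lambda>r. (h' r / (h r)\<^sup>2) *\<^sub>R w r)) has_vector_derivative
      (h' u / (h u)\<^sup>2) *\<^sub>R w u) (at u within {0..T})"
      using integral_has_vector_derivative[OF cont u] by (auto intro: derivative_eq_intros)
    from has_vector_derivative_scaleR[OF h[OF u] this]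
    have "(Y has_vector_derivative h u *\<^sub>R (h' u / (h u)\<^sup>2) *\<^sub>R w u
       + h' u *\<^sub>R (x + integral {0..u} (\<lambda>r. (h' r / (h r)\<^sup>2) *\<^sub>R w r))) (at u within {0..T})"
      unfolding Y_def .
    moreover have "h u *\<^sub>R (h' u / (h u)\<^sup>2) *\<^sub>R w u
       + h' u *\<^sub>R (x + integral {0..u} (\<lambda>r. (h' r / (h r)\<^sup>2) *\<^sub>R w r)) = (h' u / h u) *\<^sub>R X u"
      using ne[OF u] by (simp add: XY Y_def scaleR_add_right power2_eq_square)
    ultimately show ?thesis by simp
  qed
  have "((\<lambda>r. (h' r / h r) *\<^sub>R X r) has_integral Y s - Y 0) {0..s}"
    using s by (intro fundamental_theorem_of_calculus)
       (auto intro: has_vector_derivative_within_subset[OF dY])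
  then have "integral {0..s} (\<lambda>r. (h' r / h r) *\<^sub>R X r) = Y s - x"
    by (simp add: integral_unique h0 Y_def)
  then show ?thesis by (simp add: XY)
qed

text \<open>
  Cauchy-Schwarz against the constant one, read off from the nonnegative variance
  \<open>\<integral> (g - m)\<^sup>2\<close> around the mean \<open>m\<close>.
\<close>

lemma square_integral_le:
  fixes g :: "real \<Rightarrow> real"
  assumes "T > 0" and g: "continuous_on {0..T} g"
  shows "(integral {0..T} g)\<^sup>2 \<le> T * integral {0..T} (\<lambda>s. (g s)\<^sup>2)"
proof -
  define m where "m = integral {0..T} g / T"
  have "0 \<le> integral {0..T} (\<lambda>s. (g s - m)\<^sup>2)"
    by (intro integral_nonneg integrable_continuous_real continuous_intros g) auto
  also have "\<dots> = integral {0..T} (\<lambda>s. (g s)\<^sup>2 - 2 * m * g s + m\<^sup>2)"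
    by (simp add: power2_diff algebra_simps)
  also have "\<dots> = integral {0..T} (\<lambda>s. (g s)\<^sup>2) - 2 * m * integral {0..T} g + m\<^sup>2 * T"
    using assms by (subst integral_add integral_diff,
      (intro integrable_continuous_real continuous_intros g)+)+ simp
  also have "\<dots> = integral {0..T} (\<lambda>s. (g s)\<^sup>2) - (integral {0..T} g)\<^sup>2 / T"
    using \<open>T > 0\<close> by (simp add: m_def power2_eq_square field_simps)
  finally show ?thesis using \<open>T > 0\<close> by (simp add: field_simps)
qed

text \<open>
  A pathwise bound with a constant that does not depend on the path, so that square integrability
  of the noise passes to the state without a maximal inequality.
\<close>

lemma additive_noise_response_bound:
  fixes h h' :: "real \<Rightarrow> real"
  assumes T: "T > 0" and h: "continuous_on {0..T} h" and pos: "\<And>s. s \<in> {0..T} \<Longrightarrow> h s > 0"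
    and h': "continuous_on {0..T} h'"
  obtains C where "C \<ge> 0" "\<And>(w :: real \<Rightarrow> 'b::euclidean_space) s. continuous_on {0..T} w \<Longrightarrow> s \<in> {0..T} \<Longrightarrow>
     (norm (additive_noise_response h h' w s))\<^sup>2 \<le> 2 * (norm (w s))\<^sup>2 + C * integral {0..T} (\<lambda>r. (norm (w r))\<^sup>2)"
proof -
  have k: "continuous_on {0..T} (\<lambda>r. h' r / (h r)\<^sup>2)"
    using pos by (intro continuous_intros h h') force
  obtain a where a: "\<And>s. s \<in> {0..T} \<Longrightarrow> norm (h s) \<le> a"
    using compact_continuous_image[OF h] compact_imp_bounded bounded_pos by (metis compact_Icc image_eqI)
  obtain b where b: "\<And>s. s \<in> {0..T} \<Longrightarrow> norm (h' s / (h s)\<^sup>2) \<le> b"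
    using compact_continuous_image[OF k] compact_imp_bounded bounded_pos by (metis (no_types, lifting) compact_Icc image_eqI)
  have a0: "a \<ge> 0" using a[of 0] T norm_ge_zero[of "h 0"] by (meson atLeastAtMost_iff less_imp_le order_refl order_trans)
  have b0: "b \<ge> 0" using b[of 0] T norm_ge_zero[of "h' 0 / (h 0)\<^sup>2"] by (meson atLeastAtMost_iff less_imp_le order_refl order_trans)
  show ?thesis
  proof
    show "0 \<le> 2 * (a * b)\<^sup>2 * T" using T by simp
    fix w :: "real \<Rightarrow> 'b" and s assume w: "continuous_on {0..T} w" and s: "s \<in> {0..T}"
    have sub: "continuous_on {0..s} f" if "continuous_on {0..T} f" for f :: "real \<Rightarrow> 'c::topological_space"
      by (rule continuous_on_subset[OF that]) (use s in auto)
    let ?I = "integral {0..s} (\<lambda>r. (h' r / (h r)\<^sup>2) *\<^sub>R w r)"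
    have "norm ?I \<le> integral {0..s} (\<lambda>r. b * norm (w r))"
    proof (intro integral_norm_bound_integral integrable_continuous_real)
      show "continuous_on {0..s} (\<lambda>r. (h' r / (h r)\<^sup>2) *\<^sub>R w r)"
        by (rule continuous_on_scaleR[OF sub[OF k] sub[OF w]])
      show "continuous_on {0..s} (\<lambda>r. b * norm (w r))"
        by (intro continuous_intros sub[OF w])
      fix r assume "r \<in> {0..s}"
      then have "norm (h' r / (h r)\<^sup>2) \<le> b" using b[of r] s by auto
      from mult_right_mono[OF this norm_ge_zero[of "w r"]]
      show "norm ((h' r / (h r)\<^sup>2) *\<^sub>R w r) \<le> b * norm (w r)" by (simp only: norm_scaleR real_norm_def)
    qed
    also have "\<dots> \<le> integral {0..T} (\<lambda>r. b * norm (w r))"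
      using s b0 by (intro integral_subset_le integrable_continuous_real continuous_intros sub[OF w] w) auto
    finally have I: "norm ?I \<le> b * integral {0..T} (\<lambda>r. norm (w r))" by simp
    have "norm (h s *\<^sub>R ?I) \<le> a * (b * integral {0..T} (\<lambda>r. norm (w r)))"
      using a[OF s] I a0 by (auto intro!: mult_mono)
    then have "(norm (h s *\<^sub>R ?I))\<^sup>2 \<le> (a * (b * integral {0..T} (\<lambda>r. norm (w r))))\<^sup>2"
      by (intro power_mono) auto
    also have "\<dots> = (a * b)\<^sup>2 * (integral {0..T} (\<lambda>r. norm (w r)))\<^sup>2"
      by (simp add: power_mult_distrib)
    also have "\<dots> \<le> (a * b)\<^sup>2 * (T * integral {0..T} (\<lambda>r. (norm (w r))\<^sup>2))"
      by (intro mult_left_mono square_integral_le T continuous_intros w) auto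
    finally have J: "(norm (h s *\<^sub>R ?I))\<^sup>2 \<le> (a * b)\<^sup>2 * T * integral {0..T} (\<lambda>r. (norm (w r))\<^sup>2)"
      by (simp add: mult.assoc)
    have "(norm (w s + h s *\<^sub>R ?I))\<^sup>2 \<le> 2 * (norm (w s))\<^sup>2 + 2 * (norm (h s *\<^sub>R ?I))\<^sup>2"
      by (rule norm_add_sq_le)
    then show "(norm (additive_noise_response h h' w s))\<^sup>2
        \<le> 2 * (norm (w s))\<^sup>2 + 2 * (a * b)\<^sup>2 * T * integral {0..T} (\<lambda>r. (norm (w r))\<^sup>2)"
      unfolding additive_noise_response_def using J by simp
  qed
qed

section \<open>Integrals along the paths of a continuous process\<close>

text \<open>
  The process is the pointwise limit of processes that are constant in time on the intervals of
  length \<open>1 / Suc n\<close>, and these are countable combinations of measurable functions. Clipping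
  the time to \<open>[a, b]\<close> keeps the grid points inside the interval where the process is known
  to be measurable. The sigma-algebra \<open>N\<close> is arbitrary because the lemma is used for the
  whole space and for each member of a filtration.
\<close>

lemma jointly_measurable_of_continuous_paths:
  fixes Y :: "real \<Rightarrow> 'w \<Rightarrow> 'b::metric_space"
  assumes ab: "a \<le> b" and Y: "\<And>s. s \<in> {a..b} \<Longrightarrow> Y s \<in> borel_measurable N"
    and paths: "\<And>\<omega>. \<omega> \<in> space N \<Longrightarrow> continuous_on {a..b} (\<lambda>s. Y s \<omega>)"
  shows "(\<lambda>(\<omega>, s). Y (max a (min b s)) \<omega>) \<in> borel_measurable (N \<Otimes>\<^sub>M lborel)"
proof (rule borel_measurable_LIMSEQ_metric)
  let ?p = "\<lambda>s. max a (min b s)"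
  let ?r = "\<lambda>n s. real_of_int \<lfloor>real (Suc n) * s\<rfloor> / real (Suc n)"
  show "(\<lambda>(\<omega>, s). Y (?p (?r n s)) \<omega>) \<in> borel_measurable (N \<Otimes>\<^sub>M lborel)" for n
  proof -
    have "(\<lambda>z. Y (?p (real_of_int \<lfloor>real (Suc n) * snd z\<rfloor> / real (Suc n))) (fst z))
       \<in> borel_measurable (N \<Otimes>\<^sub>M lborel)"
    proof (rule measurable_compose_countable[where g = "\<lambda>z. \<lfloor>real (Suc n) * snd z\<rfloor>"])
      fix i :: int
      have "Y (?p (real_of_int i / real (Suc n))) \<in> borel_measurable N"
        using ab by (intro Y) auto
      then show "(\<lambda>z. Y (?p (real_of_int i / real (Suc n))) (fst z)) \<in> borel_measurable (N \<Otimes>\<^sub>M lborel)"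
        by (rule measurable_compose[OF measurable_fst])
    qed measurable
    then show ?thesis by (simp add: case_prod_beta')
  qed
  fix z assume "z \<in> space (N \<Otimes>\<^sub>M (lborel :: real measure))"
  then have \<omega>: "fst z \<in> space N" by (auto simp: space_pair_measure)
  have "(\<lambda>n. ?r n s) \<longlonglongrightarrow> s" for s :: real
  proof (rule tendsto_sandwich[OF always_eventually always_eventually])
    show "\<forall>n. s - 1 / real (Suc n) \<le> ?r n s"
    proof
      fix n
      have "real (Suc n) * s - 1 \<le> real_of_int \<lfloor>real (Suc n) * s\<rfloor>" by linarith
      then have "(real (Suc n) * s - 1) / real (Suc n) \<le> ?r n s"
        by (rule divide_right_mono) simp
      then show "s - 1 / real (Suc n) \<le> ?r n s" by (simp add: diff_divide_distrib)
    qed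
    show "\<forall>n. ?r n s \<le> s"
    proof
      fix n
      have "real_of_int \<lfloor>real (Suc n) * s\<rfloor> \<le> real (Suc n) * s" by linarith
      then show "?r n s \<le> s" by (simp add: divide_le_eq mult.commute)
    qed
    show "(\<lambda>n. s - 1 / real (Suc n)) \<longlonglongrightarrow> s"
      using tendsto_diff[OF tendsto_const LIMSEQ_Suc[OF lim_1_over_n], of s] by simp
  qed simp
  then have "(\<lambda>n. ?p (?r n (snd z))) \<longlonglongrightarrow> ?p (snd z)"
    by (intro tendsto_max tendsto_min tendsto_const)
  then show "(\<lambda>n. case z of (\<omega>, s) \<Rightarrow> Y (?p (?r n s)) \<omega>) \<longlonglongrightarrow> (case z of (\<omega>, s) \<Rightarrow> Y (?p s) \<omega>)"
    using continuous_on_tendsto_compose[OF paths[OF \<omega>], of "\<lambda>n. ?p (?r n (snd z))" "?p (snd z)"] ab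
    by (auto simp: case_prod_beta')
qed

lemma continuous_integral_eq_lborel:
  fixes f :: "real \<Rightarrow> 'b::euclidean_space"
  assumes "a \<le> b" "continuous_on {a..b} f"
  shows "integrable lborel (\<lambda>s. indicator {a..b} s *\<^sub>R f (max a (min b s)))"
    "integral {a..b} f = (\<integral>s. indicator {a..b} s *\<^sub>R f (max a (min b s)) \<partial>lborel)"
proof -
  have eq: "indicator {a..b} s *\<^sub>R f (max a (min b s)) = indicator {a..b} s *\<^sub>R f s" for s
    by (auto simp: indicator_def max_def min_def)
  have "set_integrable lborel {a..b} f"
    by (rule borel_integrable_atLeastAtMost') fact
  from this set_borel_integral_eq_integral(2)[OF this]
  show "integrable lborel (\<lambda>s. indicator {a..b} s *\<^sub>R f (max a (min b s)))"
    "integral {a..b} f = (\<integral>s. indicator {a..b} s *\<^sub>R f (max a (min b s)) \<partial>lborel)"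
    by (simp_all add: set_integrable_def set_lebesgue_integral_def eq)
qed

lemma measurable_path_integral:
  fixes Y :: "real \<Rightarrow> 'w \<Rightarrow> 'b::euclidean_space"
  assumes ab: "a \<le> b" and Y: "\<And>s. s \<in> {a..b} \<Longrightarrow> Y s \<in> borel_measurable N"
    and paths: "\<And>\<omega>. \<omega> \<in> space N \<Longrightarrow> continuous_on {a..b} (\<lambda>s. Y s \<omega>)"
  shows "(\<lambda>\<omega>. integral {a..b} (\<lambda>s. Y s \<omega>)) \<in> borel_measurable N"
proof -
  have [measurable]: "(\<lambda>z. Y (max a (min b (snd z))) (fst z)) \<in> borel_measurable (N \<Otimes>\<^sub>M lborel)"
    using jointly_measurable_of_continuous_paths[OF assms] by (simp add: case_prod_beta')
  have "(\<lambda>\<omega>. \<integral>s. indicator {a..b} s *\<^sub>R Y (max a (min b s)) \<omega> \<partial>lborel) \<in> borel_measurable N"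
    by (rule lborel.borel_measurable_lebesgue_integral) (simp add: case_prod_beta')
  then show ?thesis
    by (rule measurable_cong[THEN iffD1, rotated]) (simp add: continuous_integral_eq_lborel(2)[OF ab paths])
qed

text \<open>
  Tonelli's theorem exchanges the expectation with the time integral.
\<close>

lemma integrable_path_integral_nonneg:
  fixes Y :: "real \<Rightarrow> 'w \<Rightarrow> real"
  assumes M: "prob_space M" and ab: "a \<le> b" and Y: "\<And>s. s \<in> {a..b} \<Longrightarrow> Y s \<in> borel_measurable M"
    and paths: "\<And>\<omega>. \<omega> \<in> space M \<Longrightarrow> continuous_on {a..b} (\<lambda>s. Y s \<omega>)"
    and nonneg: "\<And>s \<omega>. 0 \<le> Y s \<omega>"
    and bound: "\<And>s. s \<in> {a..b} \<Longrightarrow> (\<integral>\<^sup>+\<omega>. ennreal (Y s \<omega>) \<partial>M) \<le> ennreal C"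
  shows "integrable M (\<lambda>\<omega>. integral {a..b} (\<lambda>s. Y s \<omega>))"
proof (rule integrableI_bounded)
  interpret prob_space M by fact
  interpret P: pair_sigma_finite M lborel ..
  let ?p = "\<lambda>s. max a (min b s)"
  show "(\<lambda>\<omega>. integral {a..b} (\<lambda>s. Y s \<omega>)) \<in> borel_measurable M"
    by (rule measurable_path_integral[OF ab Y paths])
  have meas: "(\<lambda>z. ennreal (indicator {a..b} (snd z) *\<^sub>R Y (?p (snd z)) (fst z))) \<in> borel_measurable (M \<Otimes>\<^sub>M lborel)"
  proof -
    have [measurable]: "(\<lambda>z. Y (?p (snd z)) (fst z)) \<in> borel_measurable (M \<Otimes>\<^sub>M lborel)"
      using jointly_measurable_of_continuous_paths[OF ab Y paths] by (simp add: case_prod_beta')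
    show ?thesis by measurable
  qed
  have "(\<integral>\<^sup>+\<omega>. ennreal (norm (integral {a..b} (\<lambda>s. Y s \<omega>))) \<partial>M)
      = (\<integral>\<^sup>+\<omega>. \<integral>\<^sup>+s. ennreal (indicator {a..b} s *\<^sub>R Y (?p s) \<omega>) \<partial>lborel \<partial>M)"
  proof (intro nn_integral_cong)
    fix \<omega> assume \<omega>: "\<omega> \<in> space M"
    have "(\<integral>\<^sup>+s. ennreal (indicator {a..b} s *\<^sub>R Y (?p s) \<omega>) \<partial>lborel)
       = ennreal (\<integral>s. indicator {a..b} s *\<^sub>R Y (?p s) \<omega> \<partial>lborel)"
      by (intro nn_integral_eq_integral continuous_integral_eq_lborel[OF ab paths[OF \<omega>]])
         (simp add: nonneg)
    moreover have "0 \<le> integral {a..b} (\<lambda>s. Y s \<omega>)"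
      by (intro integral_nonneg integrable_continuous_real paths \<omega> nonneg)
    ultimately show "ennreal (norm (integral {a..b} (\<lambda>s. Y s \<omega>)))
      = (\<integral>\<^sup>+s. ennreal (indicator {a..b} s *\<^sub>R Y (?p s) \<omega>) \<partial>lborel)"
      by (simp add: continuous_integral_eq_lborel(2)[OF ab paths[OF \<omega>]])
  qed
  also have "\<dots> = (\<integral>\<^sup>+s. \<integral>\<^sup>+\<omega>. ennreal (indicator {a..b} s *\<^sub>R Y (?p s) \<omega>) \<partial>M \<partial>lborel)"
    using P.Fubini[OF meas] by simp
  also have "\<dots> \<le> (\<integral>\<^sup>+s. ennreal C * indicator {a..b} s \<partial>lborel)"
  proof (intro nn_integral_mono)
    fix s :: real
    show "(\<integral>\<^sup>+\<omega>. ennreal (indicator {a..b} s *\<^sub>R Y (?p s) \<omega>) \<partial>M) \<le> ennreal C * indicator {a..b} s"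
      using bound[of s] by (cases "s \<in> {a..b}") (auto simp: max_def min_def)
  qed
  also have "\<dots> < \<infinity>"
    using ab by (simp add: nn_integral_cmult_indicator ennreal_mult_less_top)
  finally show "(\<integral>\<^sup>+\<omega>. ennreal (norm (integral {a..b} (\<lambda>s. Y s \<omega>))) \<partial>M) < \<infinity>" .
qed

section \<open>Brownian motion and the state of a scalar closed loop\<close>

text \<open>
  Each coordinate of \<open>W s - W 0\<close> is normal with variance \<open>s\<close>, except at \<open>s = 0\<close>,
  where the increment is zero and the definition gives no density.
\<close>

lemma brownian_increment_second_moment:
  fixes W :: "real \<Rightarrow> 'w \<Rightarrow> real^'m" and \<sigma> :: "real^'m^'n"
  assumes bm: "standard_brownian_motion M T W" and T: "T > 0"
  obtains C where "\<And>s. s \<in> {0..T} \<Longrightarrow>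
    (\<integral>\<^sup>+\<omega>. ennreal ((norm (\<sigma> *v (W s \<omega> - W 0 \<omega>)))\<^sup>2) \<partial>M) \<le> ennreal C"
proof -
  from bm interpret prob_space M by (simp add: standard_brownian_motion_def)
  obtain c where c: "\<And>x. norm (\<sigma> *v x) \<le> norm x * c"
    using bounded_linear.bounded[OF matrix_vector_mul_bounded_linear] by blast
  show ?thesis
  proof
    fix s assume s: "s \<in> {0..T}"
    show "(\<integral>\<^sup>+\<omega>. ennreal ((norm (\<sigma> *v (W s \<omega> - W 0 \<omega>)))\<^sup>2) \<partial>M) \<le> ennreal (c\<^sup>2 * (real CARD('m) * T))"
    proof (cases "s = 0")
      case True
      then show ?thesis by simp
    next
      case False
      with s have s0: "0 < s" "s \<le> T" by auto
      have dist: "distributed M lborel (\<lambda>\<omega>. (W s \<omega> - W 0 \<omega>) $ k) (\<lambda>y. ennreal (normal_density 0 (sqrt s) y))" for k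
      proof -
        have "\<forall>s u. 0 \<le> s \<longrightarrow> s < u \<longrightarrow> u \<le> T \<longrightarrow>
            (\<forall>k. distributed M lborel (\<lambda>\<omega>. (W u \<omega> - W s \<omega>) $ k)
               (\<lambda>y. ennreal (normal_density 0 (sqrt (u - s)) y)))"
          using bm unfolding standard_brownian_motion_def by blast
        from this[rule_format, of 0 s k] show ?thesis using s0 by simp
      qed
      have m: "(\<lambda>\<omega>. (W s \<omega> - W 0 \<omega>) $ k) \<in> borel_measurable M" for k
        using distributed_measurable[OF dist[of k]] by simp
      have int: "integrable M (\<lambda>\<omega>. ((W s \<omega> - W 0 \<omega>) $ k)\<^sup>2)" for k
        using integrable_normal_moment[of "sqrt s" 0 2] s0
          distributed_integrable[OF dist[of k], of "\<lambda>y. y\<^sup>2"] by simp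
      have var: "(\<integral>\<omega>. ((W s \<omega> - W 0 \<omega>) $ k)\<^sup>2 \<partial>M) = s" for k
        using normal_distributed_variance[OF _ dist[of k]] normal_distributed_expectation[OF _ dist[of k]] s0
        by simp
      have pt: "(norm (\<sigma> *v (W s \<omega> - W 0 \<omega>)))\<^sup>2 \<le> c\<^sup>2 * (\<Sum>k\<in>UNIV. ((W s \<omega> - W 0 \<omega>) $ k)\<^sup>2)" for \<omega>
      proof -
        have "(norm (\<sigma> *v (W s \<omega> - W 0 \<omega>)))\<^sup>2 \<le> (norm (W s \<omega> - W 0 \<omega>) * c)\<^sup>2"
          by (intro power_mono c) auto
        also have "\<dots> = c\<^sup>2 * (\<Sum>k\<in>UNIV. ((W s \<omega> - W 0 \<omega>) $ k)\<^sup>2)"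
          by (simp add: power_mult_distrib norm_vec_def L2_set_def sum_nonneg)
        finally show ?thesis .
      qed
      have "(\<integral>\<^sup>+\<omega>. ennreal ((norm (\<sigma> *v (W s \<omega> - W 0 \<omega>)))\<^sup>2) \<partial>M)
          \<le> (\<integral>\<^sup>+\<omega>. ennreal (c\<^sup>2 * (\<Sum>k\<in>UNIV. ((W s \<omega> - W 0 \<omega>) $ k)\<^sup>2)) \<partial>M)"
        by (intro nn_integral_mono ennreal_leI pt)
      also have "\<dots> = ennreal (\<integral>\<omega>. c\<^sup>2 * (\<Sum>k\<in>UNIV. ((W s \<omega> - W 0 \<omega>) $ k)\<^sup>2) \<partial>M)"
        by (intro nn_integral_eq_integral integrable_mult_right Bochner_Integration.integrable_sum int)
           (auto intro!: sum_nonneg mult_nonneg_nonneg)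
      also have "(\<integral>\<omega>. c\<^sup>2 * (\<Sum>k\<in>UNIV. ((W s \<omega> - W 0 \<omega>) $ k)\<^sup>2) \<partial>M) = c\<^sup>2 * (real CARD('m) * s)"
        using int var by (simp add: Bochner_Integration.integral_sum del: vector_minus_component)
      also have "ennreal \<dots> \<le> ennreal (c\<^sup>2 * (real CARD('m) * T))"
        using s0 by (intro ennreal_leI mult_left_mono) auto
      finally show ?thesis .
    qed
  qed
qed

lemma brownian_filtration_subset:
  assumes "standard_brownian_motion M T W" "s \<le> T"
  shows "sets (brownian_filtration M W s) \<subseteq> sets M" "space (brownian_filtration M W s) = space M"
proof -
  have "(\<Union>u\<in>{0..s}. {W u -` S \<inter> space M | S. S \<in> sets borel}) \<union> null_sets M \<subseteq> sets M"
  proof -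
    have "W u -` S \<inter> space M \<in> sets M" if "u \<in> {0..s}" "S \<in> sets borel" for u S
    proof -
      have "W u \<in> borel_measurable M"
        using assms that by (auto simp: standard_brownian_motion_def)
      then show ?thesis using that(2) by (rule measurable_sets)
    qed
    then show ?thesis by (auto simp: null_sets_def)
  qed
  moreover from this have "(\<Union>u\<in>{0..s}. {W u -` S \<inter> space M | S. S \<in> sets borel}) \<union> null_sets M \<subseteq> Pow (space M)"
    using sets.sets_into_space by blast
  ultimately show "sets (brownian_filtration M W s) \<subseteq> sets M" "space (brownian_filtration M W s) = space M"
    unfolding brownian_filtration_def
    by (simp_all add: sets_measure_of sets.sigma_sets_subset space_measure_of)
qed

lemma brownian_filtration_measurable:
  assumes "standard_brownian_motion M T W" "s \<le> T"
    "f \<in> borel_measurable (brownian_filtration M W s)"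
  shows "f \<in> borel_measurable M"
  using brownian_filtration_subset[OF assms(1,2)] assms(3)
  by (auto simp: measurable_def)

lemma brownian_filtration_contains:
  assumes bm: "standard_brownian_motion M T W" and "s \<le> T"
  shows "N \<in> null_sets M \<Longrightarrow> N \<in> sets (brownian_filtration M W s)"
    "0 \<le> r \<Longrightarrow> r \<le> s \<Longrightarrow> W r \<in> borel_measurable (brownian_filtration M W s)"
proof -
  let ?G = "(\<Union>u\<in>{0..s}. {W u -` S \<inter> space M | S. S \<in> sets borel}) \<union> null_sets M"
  have "?G \<subseteq> Pow (space M)"
    using sets.sets_into_space by (auto simp: null_sets_def)
  then have sets: "sets (brownian_filtration M W s) = sigma_sets (space M) ?G"
    unfolding brownian_filtration_def by (simp add: sets_measure_of)
  show "N \<in> null_sets M \<Longrightarrow> N \<in> sets (brownian_filtration M W s)"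
    unfolding sets by (intro sigma_sets.Basic) auto
  assume r: "0 \<le> r" "r \<le> s"
  show "W r \<in> borel_measurable (brownian_filtration M W s)"
  proof (rule measurableI)
    fix S :: "(real^'b) set" assume "S \<in> sets borel"
    then have "W r -` S \<inter> space M \<in> ?G" using r by auto
    then show "W r -` S \<inter> space (brownian_filtration M W s) \<in> sets (brownian_filtration M W s)"
      using brownian_filtration_subset[OF assms] unfolding sets by (auto intro: sigma_sets.Basic)
  qed simp
qed

text \<open>
  The Brownian paths are continuous only off a null set. Replacing the noise by zero there makes
  every path continuous, as a state process requires, and keeps the process adapted
  because the filtration contains the null sets.
\<close>

lemma continuous_noise_version:
  fixes W :: "real \<Rightarrow> 'w \<Rightarrow> real^'m" and \<sigma> :: "real^'m^'n"
  assumes bm: "standard_brownian_motion M T W" and T: "T > 0"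
  obtains w C where "\<And>\<omega>. w 0 \<omega> = (0 :: real^'n)" "\<And>\<omega>. continuous_on {0..T} (\<lambda>s. w s \<omega>)"
    "AE \<omega> in M. \<forall>s. w s \<omega> = \<sigma> *v (W s \<omega> - W 0 \<omega>)"
    "\<And>r s. 0 \<le> r \<Longrightarrow> r \<le> s \<Longrightarrow> s \<le> T \<Longrightarrow> w r \<in> borel_measurable (brownian_filtration M W s)"
    "\<And>s. s \<in> {0..T} \<Longrightarrow> (\<integral>\<^sup>+\<omega>. ennreal ((norm (w s \<omega>))\<^sup>2) \<partial>M) \<le> ennreal C"
proof -
  have "AE \<omega> in M. continuous_on {0..T} (\<lambda>s. W s \<omega>)"
    using bm unfolding standard_brownian_motion_def by blast
  then obtain N where N: "{\<omega> \<in> space M. \<not> continuous_on {0..T} (\<lambda>s. W s \<omega>)} \<subseteq> N" "N \<in> null_sets M"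
    by (auto elim!: AE_E simp: null_sets_def)
  define w where "w s \<omega> = (if \<omega> \<in> space M - N then \<sigma> *v (W s \<omega> - W 0 \<omega>) else 0)" for s \<omega>
  obtain C where C: "\<And>s. s \<in> {0..T} \<Longrightarrow>
    (\<integral>\<^sup>+\<omega>. ennreal ((norm (\<sigma> *v (W s \<omega> - W 0 \<omega>)))\<^sup>2) \<partial>M) \<le> ennreal C"
    using brownian_increment_second_moment[OF bm T] by metis
  have ae: "AE \<omega> in M. \<forall>s. w s \<omega> = \<sigma> *v (W s \<omega> - W 0 \<omega>)"
    using AE_not_in[OF N(2)] AE_space by eventually_elim (auto simp: w_def)
  show ?thesis
  proof
    show "w 0 \<omega> = 0" for \<omega> by (simp add: w_def)
    show "continuous_on {0..T} (\<lambda>s. w s \<omega>)" for \<omega>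
    proof (cases "\<omega> \<in> space M - N")
      case True
      then have "continuous_on {0..T} (\<lambda>s. W s \<omega>)" using N(1) by auto
      then show ?thesis using True unfolding w_def by (auto intro!: continuous_intros)
    next
      case False
      then show ?thesis by (simp only: w_def if_False continuous_on_const)
    qed
    show "AE \<omega> in M. \<forall>s. w s \<omega> = \<sigma> *v (W s \<omega> - W 0 \<omega>)" by fact
    show "w r \<in> borel_measurable (brownian_filtration M W s)" if "0 \<le> r" "r \<le> s" "s \<le> T" for r s
    proof -
      let ?F = "brownian_filtration M W s"
      have [measurable]: "W r \<in> borel_measurable ?F" "W 0 \<in> borel_measurable ?F" "N \<in> sets ?F"
        using brownian_filtration_contains[OF bm, of s] that N(2) by auto
      have sp: "space M = space ?F" using brownian_filtration_subset(2)[OF bm] that by simp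
      have [measurable]: "(\<lambda>\<omega>. \<sigma> *v (W r \<omega> - W 0 \<omega>)) \<in> borel_measurable ?F"
        by (rule measurable_compose[of _ _ borel])
           (auto intro!: borel_measurable_continuous_onI continuous_intros)
      show ?thesis unfolding w_def sp by measurable
    qed
    show "(\<integral>\<^sup>+\<omega>. ennreal ((norm (w s \<omega>))\<^sup>2) \<partial>M) \<le> ennreal C" if "s \<in> {0..T}" for s
    proof -
      have "(\<integral>\<^sup>+\<omega>. ennreal ((norm (w s \<omega>))\<^sup>2) \<partial>M) = (\<integral>\<^sup>+\<omega>. ennreal ((norm (\<sigma> *v (W s \<omega> - W 0 \<omega>)))\<^sup>2) \<partial>M)"
        using ae by (intro nn_integral_cong_AE) auto
      then show ?thesis using C[OF that] by simp
    qed
  qed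
qed

lemma scalar_closed_loop_drift:
  fixes A :: "real^'n^'n" and B :: "real^'a^'n" and K :: "real^'n^'a"
  assumes "A + B ** K = c *\<^sub>R mat 1"
  shows "A *v y + B *v (K *v y) = c *\<^sub>R y"
proof -
  have "A *v y + B *v (K *v y) = (A + B ** K) *v y"
    by (simp add: matrix_vector_mult_add_rdistrib matrix_vector_mul_assoc)
  then show ?thesis
    unfolding assms by (simp add: scaleR_matrix_vector_assoc[symmetric])
qed

text \<open>
  Existence and uniqueness of the state process: pathwise, the state equation is the scalar
  equation solved above. Adaptedness holds because the noise response at time \<open>s\<close> is an
  integral over \<open>[0, s]\<close> of a process that is measurable at time \<open>s\<close>.
\<close>

lemma scalar_closed_loop_state:
  fixes W :: "real \<Rightarrow> 'w \<Rightarrow> real^'m" and \<sigma> :: "real^'m^'n" and B :: "real \<Rightarrow> real^'a^'n"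
  assumes bm: "standard_brownian_motion M T W" and T: "T > 0"
    and h: "\<And>s. s \<in> {0..T} \<Longrightarrow> (h has_real_derivative h' s) (at s within {0..T})"
    and pos: "\<And>s. s \<in> {0..T} \<Longrightarrow> h s > 0" and h0: "h 0 = 1" and h': "continuous_on {0..T} h'"
    and loop: "\<And>s. s \<in> {0..T} \<Longrightarrow> A s + B s ** K s = (h' s / h s) *\<^sub>R mat 1"
    and u: "\<And>s y. s \<in> {0..T} \<Longrightarrow> u (s, y) = K s *v y"
    and w0: "\<And>\<omega>. w 0 \<omega> = 0" and w: "\<And>\<omega>. continuous_on {0..T} (\<lambda>s. w s \<omega>)"
    and wW: "AE \<omega> in M. \<forall>s. w s \<omega> = \<sigma> *v (W s \<omega> - W 0 \<omega>)"
    and wm: "\<And>r s. 0 \<le> r \<Longrightarrow> r \<le> s \<Longrightarrow> s \<le> T \<Longrightarrow> w r \<in> borel_measurable (brownian_filtration M W s)"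
  shows "state_process M W T A B \<sigma> u (0, x)
      (\<lambda>s \<omega>. h s *\<^sub>R x + additive_noise_response h h' (\<lambda>r. w r \<omega>) s)" (is "state_process _ _ _ _ _ _ _ _ ?X")
    and "state_process M W T A B \<sigma> u (0, x) X \<Longrightarrow>
      AE \<omega> in M. \<forall>s\<in>{0..T}. X s \<omega> = h s *\<^sub>R x + additive_noise_response h h' (\<lambda>r. w r \<omega>) s"
proof -
  have hc: "continuous_on {0..T} h"
    using h by (rule DERIV_continuous_on)
  have drift: "integral {0..s} (\<lambda>r. A r *v y r + B r *v u (r, y r)) = integral {0..s} (\<lambda>r. (h' r / h r) *\<^sub>R y r)"
    if "s \<in> {0..T}" for s y
    using that scalar_closed_loop_drift[OF loop] by (intro integral_cong) (auto simp: u)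
  have k: "continuous_on {0..T} (\<lambda>r. h' r / (h r)\<^sup>2)"
    using pos by (intro continuous_intros hc h') force
  show "state_process M W T A B \<sigma> u (0, x) ?X"
    unfolding state_process_def prod.case
  proof (intro conjI ballI)
    show "?X s \<in> borel_measurable (brownian_filtration M W s)" if s: "s \<in> {0..T}" for s
    proof -
      let ?F = "brownian_filtration M W s"
      have [measurable]: "w r \<in> borel_measurable ?F" if "r \<in> {0..s}" for r
        using that s by (intro wm) auto
      have "continuous_on {0..s} (\<lambda>r. (h' r / (h r)\<^sup>2) *\<^sub>R w r \<omega>)" for \<omega>
        by (rule continuous_on_subset[OF continuous_on_scaleR[OF k w]]) (use s in auto)
      then have "(\<lambda>\<omega>. integral {0..s} (\<lambda>r. (h' r / (h r)\<^sup>2) *\<^sub>R w r \<omega>)) \<in> borel_measurable ?F"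
        using s by (intro measurable_path_integral) auto
      moreover have "w s \<in> borel_measurable ?F" using s by (intro wm) auto
      ultimately show ?thesis
        unfolding additive_noise_response_def by measurable
    qed
    show "continuous_on {0..T} (\<lambda>s. ?X s \<omega>)" for \<omega>
      by (intro continuous_intros hc additive_noise_response_continuous pos h' w)
    show "AE \<omega> in M. \<forall>s\<in>{0..T}. ?X s \<omega> = x
        + integral {0..s} (\<lambda>r. A r *v ?X r \<omega> + B r *v u (r, ?X r \<omega>)) + \<sigma> *v (W s \<omega> - W 0 \<omega>)"
      using wW
    proof eventually_elim
      case (elim \<omega>)
      show ?case
      proof
        fix s assume s: "s \<in> {0..T}"
        show "?X s \<omega> = x + integral {0..s} (\<lambda>r. A r *v ?X r \<omega> + B r *v u (r, ?X r \<omega>)) + \<sigma> *v (W s \<omega> - W 0 \<omega>)"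
        proof -
          have "?X s \<omega> = x + integral {0..s} (\<lambda>r. (h' r / h r) *\<^sub>R ?X r \<omega>) + w s \<omega>"
            by (rule scalar_equation_existence[OF h pos h0 h' w[of \<omega>] s])
          then show ?thesis using elim by (simp add: drift[OF s])
        qed
      qed
    qed
  qed
  assume X: "state_process M W T A B \<sigma> u (0, x) X"
  have "AE \<omega> in M. \<forall>s\<in>{0..T}. X s \<omega> = x
      + integral {0..s} (\<lambda>r. A r *v X r \<omega> + B r *v u (r, X r \<omega>)) + \<sigma> *v (W s \<omega> - W 0 \<omega>)"
    and paths: "\<And>\<omega>. \<omega> \<in> space M \<Longrightarrow> continuous_on {0..T} (\<lambda>s. X s \<omega>)"
    using X by (auto simp: state_process_def)
  from this(1) wW AE_space show "AE \<omega> in M. \<forall>s\<in>{0..T}. X s \<omega> = h s *\<^sub>R x + additive_noise_response h h' (\<lambda>r. w r \<omega>) s"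
  proof eventually_elim
    case (elim \<omega>)
    have "X s \<omega> = x + integral {0..s} (\<lambda>r. (h' r / h r) *\<^sub>R X r \<omega>) + w s \<omega>" if "s \<in> {0..T}" for s
      using elim that by (simp add: drift[OF that])
    then show ?case
      by (intro ballI scalar_equation_unique[where X = "\<lambda>s. X s \<omega>" and w = "\<lambda>s. w s \<omega>",
            OF h pos h0 paths[OF elim(3)] h' _ w0[of \<omega>]]) auto
  qed
qed

section \<open>Values of profiles with scalar closed loop\<close>

text \<open>
  The cost is dominated by an affine function of \<open>\<integral> |w|\<^sup>2\<close> and
  \<open>|w T|\<^sup>2\<close>, both of which have finite expectation.
\<close>

lemma quadratic_cost_integrable:
  fixes w :: "real \<Rightarrow> 'w \<Rightarrow> real^'n" and P :: "real \<Rightarrow> real^'n^'n"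
  assumes M: "prob_space M" and T: "T > 0"
    and h: "continuous_on {0..T} h" and pos: "\<And>s. s \<in> {0..T} \<Longrightarrow> h s > 0" and h': "continuous_on {0..T} h'"
    and w: "\<And>\<omega>. continuous_on {0..T} (\<lambda>s. w s \<omega>)"
    and wm: "\<And>s. s \<in> {0..T} \<Longrightarrow> w s \<in> borel_measurable M"
    and w2: "\<And>s. s \<in> {0..T} \<Longrightarrow> (\<integral>\<^sup>+\<omega>. ennreal ((norm (w s \<omega>))\<^sup>2) \<partial>M) \<le> ennreal C"
    and X: "\<And>\<omega>. \<omega> \<in> space M \<Longrightarrow> continuous_on {0..T} (\<lambda>s. X s \<omega>)"
    and Xm: "\<And>s. s \<in> {0..T} \<Longrightarrow> X s \<in> borel_measurable M"
    and Xw: "AE \<omega> in M. \<forall>s\<in>{0..T}. X s \<omega> = h s *\<^sub>R x + additive_noise_response h h' (\<lambda>r. w r \<omega>) s"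
    and P: "continuous_on {0..T} P"
  shows "integrable M (\<lambda>\<omega>. integral {0..T} (\<lambda>s. X s \<omega> \<bullet> (P s *v X s \<omega>)) + X T \<omega> \<bullet> (G *v X T \<omega>))"
proof -
  interpret prob_space M by fact
  obtain D where D: "D \<ge> 0" "\<And>(w :: real \<Rightarrow> real^'n) s. continuous_on {0..T} w \<Longrightarrow> s \<in> {0..T} \<Longrightarrow>
     (norm (additive_noise_response h h' w s))\<^sup>2 \<le> 2 * (norm (w s))\<^sup>2 + D * integral {0..T} (\<lambda>r. (norm (w r))\<^sup>2)"
    by (rule additive_noise_response_bound[OF T h pos h']) (assumption, rule that)
  obtain c where c: "c \<ge> 0" "\<And>s y. s \<in> {0..T} \<Longrightarrow> \<bar>y \<bullet> (P s *v y)\<bar> \<le> c * (norm y)\<^sup>2"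
    by (rule quadratic_form_bound[OF compact_Icc P]) (rule that)
  obtain g where g: "g \<ge> 0" "\<And>s y. s \<in> {0..0::real} \<Longrightarrow> \<bar>y \<bullet> (G *v y)\<bar> \<le> g * (norm y)\<^sup>2"
    by (rule quadratic_form_bound[OF compact_Icc continuous_on_const]) (rule that)
  have "continuous_on {0..T} (\<lambda>s. (norm (h s *\<^sub>R x))\<^sup>2)"
    by (intro continuous_intros h)
  from compact_imp_bounded[OF compact_continuous_image[OF this compact_Icc]]
  obtain a where a: "a > 0" "\<And>s. s \<in> {0..T} \<Longrightarrow> (norm (h s *\<^sub>R x))\<^sup>2 \<le> a"
    by (auto simp: bounded_pos)
  define I where "I \<omega> = integral {0..T} (\<lambda>r. (norm (w r \<omega>))\<^sup>2)" for \<omega>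
  define E where "E \<omega> = 2 * a + 2 * D * I \<omega>" for \<omega>
  have intI: "integrable M I"
    unfolding I_def
  proof (rule integrable_path_integral_nonneg[OF M _ _ _ _ w2])
    show "(\<lambda>\<omega>. (norm (w s \<omega>))\<^sup>2) \<in> borel_measurable M" if "s \<in> {0..T}" for s
      using wm[OF that] by measurable
  qed (use T in \<open>auto intro!: continuous_intros w\<close>)
  have intw: "integrable M (\<lambda>\<omega>. (norm (w T \<omega>))\<^sup>2)"
  proof (rule integrableI_bounded)
    show "(\<lambda>\<omega>. (norm (w T \<omega>))\<^sup>2) \<in> borel_measurable M"
    proof -
      have [measurable]: "w T \<in> borel_measurable M" using T by (intro wm) simp
      show ?thesis by measurable
    qed
    show "(\<integral>\<^sup>+\<omega>. ennreal (norm ((norm (w T \<omega>))\<^sup>2)) \<partial>M) < \<infinity>"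
      using w2[of T] T by (simp add: le_less_trans)
  qed
  have qc: "continuous_on {0..T} (\<lambda>s. X s \<omega> \<bullet> (P s *v X s \<omega>))" if "\<omega> \<in> space M" for \<omega>
    by (intro continuous_intros X that P)
  show ?thesis
  proof (rule Bochner_Integration.integrable_bound)
    show "integrable M (\<lambda>\<omega>. c * (E \<omega> * T + 4 * I \<omega>) + g * (E \<omega> + 4 * (norm (w T \<omega>))\<^sup>2))"
      unfolding E_def by (intro Bochner_Integration.integrable_add integrable_mult_right integrable_mult_left integrable_const intI intw)
    have "(\<lambda>\<omega>. integral {0..T} (\<lambda>s. X s \<omega> \<bullet> (P s *v X s \<omega>))) \<in> borel_measurable M"
    proof (rule measurable_path_integral)
      show "(\<lambda>\<omega>. X s \<omega> \<bullet> (P s *v X s \<omega>)) \<in> borel_measurable M" if "s \<in> {0..T}" for s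
        by (rule measurable_compose[OF Xm[OF that]])
           (auto intro!: borel_measurable_continuous_onI continuous_intros)
    qed (use T qc in auto)
    moreover have "(\<lambda>\<omega>. X T \<omega> \<bullet> (G *v X T \<omega>)) \<in> borel_measurable M"
      by (rule measurable_compose[OF Xm[of T]])
         (use T in \<open>auto intro!: borel_measurable_continuous_onI continuous_intros\<close>)
    ultimately show "(\<lambda>\<omega>. integral {0..T} (\<lambda>s. X s \<omega> \<bullet> (P s *v X s \<omega>)) + X T \<omega> \<bullet> (G *v X T \<omega>)) \<in> borel_measurable M"
      by measurable
    show "AE \<omega> in M. norm (integral {0..T} (\<lambda>s. X s \<omega> \<bullet> (P s *v X s \<omega>)) + X T \<omega> \<bullet> (G *v X T \<omega>))
        \<le> norm (c * (E \<omega> * T + 4 * I \<omega>) + g * (E \<omega> + 4 * (norm (w T \<omega>))\<^sup>2))"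
      using Xw AE_space
    proof eventually_elim
      case (elim \<omega>)
      have Xs: "(norm (X s \<omega>))\<^sup>2 \<le> E \<omega> + 4 * (norm (w s \<omega>))\<^sup>2" if s: "s \<in> {0..T}" for s
      proof -
        have "(norm (X s \<omega>))\<^sup>2 \<le> 2 * (norm (h s *\<^sub>R x))\<^sup>2
            + 2 * (norm (additive_noise_response h h' (\<lambda>r. w r \<omega>) s))\<^sup>2"
          using elim(1) s norm_add_sq_le by metis
        also have "\<dots> \<le> 2 * a + 2 * (2 * (norm (w s \<omega>))\<^sup>2 + D * I \<omega>)"
          unfolding I_def by (intro add_mono mult_left_mono a(2) D(2) w s) auto
        finally show ?thesis by (simp add: E_def)
      qed
      have "norm (integral {0..T} (\<lambda>s. X s \<omega> \<bullet> (P s *v X s \<omega>)))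
         \<le> integral {0..T} (\<lambda>s. c * E \<omega> + c * 4 * (norm (w s \<omega>))\<^sup>2)"
      proof (intro integral_norm_bound_integral integrable_continuous_real qc elim)
        show "continuous_on {0..T} (\<lambda>s. c * E \<omega> + c * 4 * (norm (w s \<omega>))\<^sup>2)"
          by (intro continuous_intros w)
        fix s assume s: "s \<in> {0..T}"
        have "\<bar>X s \<omega> \<bullet> (P s *v X s \<omega>)\<bar> \<le> c * (norm (X s \<omega>))\<^sup>2" by (rule c(2)[OF s])
        also have "\<dots> \<le> c * (E \<omega> + 4 * (norm (w s \<omega>))\<^sup>2)"
          by (intro mult_left_mono Xs s c)
        finally show "norm (X s \<omega> \<bullet> (P s *v X s \<omega>)) \<le> c * E \<omega> + c * 4 * (norm (w s \<omega>))\<^sup>2"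
          by (simp add: algebra_simps)
      qed
      also have "\<dots> = c * (E \<omega> * T + 4 * I \<omega>)"
        using T unfolding I_def
        by (subst integral_add) (auto intro!: integrable_continuous_real continuous_intros w simp: algebra_simps)
      finally have 1: "norm (integral {0..T} (\<lambda>s. X s \<omega> \<bullet> (P s *v X s \<omega>))) \<le> c * (E \<omega> * T + 4 * I \<omega>)" .
      have "\<bar>X T \<omega> \<bullet> (G *v X T \<omega>)\<bar> \<le> g * (norm (X T \<omega>))\<^sup>2" by (rule g(2)[of 0]) simp
      also have "\<dots> \<le> g * (E \<omega> + 4 * (norm (w T \<omega>))\<^sup>2)"
        using T by (intro mult_left_mono Xs g) auto
      finally show ?case using 1 by simp
    qed
  qed
qed

definition closed_loop_weight ::
    "(real \<Rightarrow> real^'n^'n) \<Rightarrow> (real \<Rightarrow> real^'a^'a) \<Rightarrow> (real \<Rightarrow> real^'n^'a) \<Rightarrow> real \<Rightarrow> real^'n^'n" where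
  "closed_loop_weight Q R K s = Q s + transpose (K s) ** R s ** K s"

lemma closed_loop_weight_form:
  "y \<bullet> (closed_loop_weight Q R K s *v y) = y \<bullet> (Q s *v y) + (K s *v y) \<bullet> (R s *v (K s *v y))"
proof -
  have "y \<bullet> (transpose (K s) *v z) = (K s *v y) \<bullet> z" for z
    by (metis inner_matrix_transpose transpose_transpose)
  then show ?thesis
    unfolding closed_loop_weight_def
    by (simp only: matrix_vector_mult_add_rdistrib inner_add_right matrix_vector_mul_assoc[symmetric])
qed

lemma continuous_closed_loop_weight [continuous_intros]:
  "continuous_on S Q \<Longrightarrow> continuous_on S R \<Longrightarrow> continuous_on S K \<Longrightarrow>
    continuous_on S (closed_loop_weight Q R K)"
  unfolding closed_loop_weight_def by (intro continuous_intros)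

text \<open>
  The reduction of the game to a deterministic cost: for almost every path, the second difference
  of the pathwise costs in the start equals the same constant, so the law of the noise enters
  only through integrability.
\<close>

lemma lq_value_second_difference:
  fixes W :: "real \<Rightarrow> 'w \<Rightarrow> real^'m" and \<sigma> :: "real^'m^'n" and B :: "real \<Rightarrow> real^'a^'n"
  assumes bm: "standard_brownian_motion M T W" and T: "T > 0"
    and h: "\<And>s. s \<in> {0..T} \<Longrightarrow> (h has_real_derivative h' s) (at s within {0..T})"
    and pos: "\<And>s. s \<in> {0..T} \<Longrightarrow> h s > 0" and h0: "h 0 = 1" and h': "continuous_on {0..T} h'"
    and loop: "\<And>s. s \<in> {0..T} \<Longrightarrow> A s + B s ** K s = (h' s / h s) *\<^sub>R mat 1"
    and u: "\<And>s y. s \<in> {0..T} \<Longrightarrow> joint_policy own \<phi> (s, y) = K s *v y"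
    and Q: "continuous_on {0..T} (Q i)" and R: "continuous_on {0..T} (R i)" and K: "continuous_on {0..T} K"
  shows "lq_value M W T own A B \<sigma> Q R G i \<phi> (0, x) + lq_value M W T own A B \<sigma> Q R G i \<phi> (0, - x)
      - 2 * lq_value M W T own A B \<sigma> Q R G i \<phi> (0, 0)
    = integral {0..T} (\<lambda>s. (h s)\<^sup>2 * (x \<bullet> (closed_loop_weight (Q i) (R i) K s *v x))) + (h T)\<^sup>2 * (x \<bullet> (G i *v x))"
proof -
  let ?P = "closed_loop_weight (Q i) (R i) K" and ?u = "joint_policy own \<phi>"
  from bm interpret prob_space M by (simp add: standard_brownian_motion_def)
  have hc: "continuous_on {0..T} h"
    using h by (rule DERIV_continuous_on)
  have P: "continuous_on {0..T} ?P" by (intro continuous_intros Q R K)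
  obtain w C where w0: "\<And>\<omega>. w 0 \<omega> = (0 :: real^'n)" and w: "\<And>\<omega>. continuous_on {0..T} (\<lambda>s. w s \<omega>)"
    and wW: "AE \<omega> in M. \<forall>s. w s \<omega> = \<sigma> *v (W s \<omega> - W 0 \<omega>)"
    and wm: "\<And>r s. 0 \<le> r \<Longrightarrow> r \<le> s \<Longrightarrow> s \<le> T \<Longrightarrow> w r \<in> borel_measurable (brownian_filtration M W s)"
    and w2: "\<And>s. s \<in> {0..T} \<Longrightarrow> (\<integral>\<^sup>+\<omega>. ennreal ((norm (w s \<omega>))\<^sup>2) \<partial>M) \<le> ennreal C"
    by (rule continuous_noise_version[OF bm T, of \<sigma>]) (rule that)
  define Z where "Z s \<omega> = additive_noise_response h h' (\<lambda>r. w r \<omega>) s" for s \<omega>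
  have Zc: "continuous_on {0..T} (\<lambda>s. Z s \<omega>)" for \<omega>
    unfolding Z_def by (intro additive_noise_response_continuous hc pos h' w)
  have existence: "state_process M W T A B \<sigma> ?u (0, y) (\<lambda>s \<omega>. h s *\<^sub>R y + Z s \<omega>)" for y
    unfolding Z_def by (rule scalar_closed_loop_state(1)[OF bm T h pos h0 h' loop u w0 w wW wm])
  have uniqueness: "AE \<omega> in M. \<forall>s\<in>{0..T}. X s \<omega> = h s *\<^sub>R y + Z s \<omega>"
    if "state_process M W T A B \<sigma> ?u (0, y) X" for X y
    unfolding Z_def by (rule scalar_closed_loop_state(2)[OF bm T h pos h0 h' loop u w0 w wW wm that])
  define X where "X y = (SOME X. state_process M W T A B \<sigma> ?u (0, y) X)" for y
  have X: "state_process M W T A B \<sigma> ?u (0, y) (X y)" for y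
    unfolding X_def
    by (rule someI[where P = "state_process M W T A B \<sigma> ?u (0, y)", OF existence])
  have Xp: "continuous_on {0..T} (\<lambda>s. X y s \<omega>)" if "\<omega> \<in> space M" for y \<omega>
    using X[of y] that by (auto simp: state_process_def)
  have Xm: "X y s \<in> borel_measurable M" if "s \<in> {0..T}" for y s
    using X[of y] that by (intro brownian_filtration_measurable[OF bm, of s]) (auto simp: state_process_def)
  have XZ: "AE \<omega> in M. \<forall>s\<in>{0..T}. X y s \<omega> = h s *\<^sub>R y + Z s \<omega>" for y
    by (rule uniqueness[OF X])
  define cost where "cost y \<omega> = integral {0..T} (\<lambda>s. X y s \<omega> \<bullet> (?P s *v X y s \<omega>)) + X y T \<omega> \<bullet> (G i *v X y T \<omega>)" for y \<omega>
  have int: "integrable M (cost y)" for y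
    unfolding cost_def
    by (rule quadratic_cost_integrable[OF prob_space_axioms T hc pos h' w _ w2 Xp Xm XZ[unfolded Z_def] P])
       (auto intro: brownian_filtration_measurable[OF bm] wm)
  have value_eq: "lq_value M W T own A B \<sigma> Q R G i \<phi> (0, y) = (\<integral>\<omega>. cost y \<omega> \<partial>M) / 2" for y
  proof -
    have "integral {0..T} (\<lambda>s. X y s \<omega> \<bullet> (Q i s *v X y s \<omega>) + ?u (s, X y s \<omega>) \<bullet> (R i s *v ?u (s, X y s \<omega>)))
      = integral {0..T} (\<lambda>s. X y s \<omega> \<bullet> (?P s *v X y s \<omega>))" for \<omega>
      by (intro integral_cong) (simp add: closed_loop_weight_form u)
    then show ?thesis
      by (simp add: lq_value_def Let_def cost_def flip: X_def)
  qed
  let ?J = "integral {0..T} (\<lambda>s. (h s)\<^sup>2 * (x \<bullet> (?P s *v x))) + (h T)\<^sup>2 * (x \<bullet> (G i *v x))"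
  have "AE \<omega> in M. cost x \<omega> + cost (- x) \<omega> - 2 * cost 0 \<omega> = 2 * ?J"
    using XZ[of x] XZ[of "- x"] XZ[of 0] AE_space
  proof eventually_elim
    case (elim \<omega>)
    let ?q = "\<lambda>y s. X y s \<omega> \<bullet> (?P s *v X y s \<omega>)"
    have iq: "?q y integrable_on {0..T}" for y
      by (intro integrable_continuous_real continuous_intros Xp elim P)
    have par: "X x s \<omega> \<bullet> (N *v X x s \<omega>) + X (- x) s \<omega> \<bullet> (N *v X (- x) s \<omega>) - 2 * (X 0 s \<omega> \<bullet> (N *v X 0 s \<omega>))
        = 2 * ((h s)\<^sup>2 * (x \<bullet> (N *v x)))" if "s \<in> {0..T}" for s and N :: "real^'n^'n"
      using quadratic_form_parallelogram[of "h s *\<^sub>R x" "Z s \<omega>" N] elim that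
      by (simp add: matrix_vector_mult_scaleR power2_eq_square)
    have "integral {0..T} (?q x) + integral {0..T} (?q (- x)) - 2 * integral {0..T} (?q 0)
       = integral {0..T} (\<lambda>s. ?q x s + ?q (- x) s - 2 * ?q 0 s)"
      using iq[of x] iq[of "- x"] iq[of 0] by (simp add: integral_add integral_diff integrable_add)
    also have "\<dots> = integral {0..T} (\<lambda>s. 2 * ((h s)\<^sup>2 * (x \<bullet> (?P s *v x))))"
      using par by (intro integral_cong) auto
    finally show ?case
      using par[of T "G i"] T by (simp add: cost_def)
  qed
  then have "(\<integral>\<omega>. cost x \<omega> + cost (- x) \<omega> - 2 * cost 0 \<omega> \<partial>M) = (\<integral>\<omega>. 2 * ?J \<partial>M)"
    by (intro integral_cong_AE) (auto intro!: borel_measurable_integrable int)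
  also have "\<dots> = 2 * ?J" by (simp add: prob_space)
  finally show ?thesis
    using int by (simp add: value_eq)
qed

section \<open>Test functions and variational identities\<close>

lemma nonneg_integral_zero:
  fixes f :: "real \<Rightarrow> real"
  assumes "continuous_on {0..s} f" "\<And>r. r \<in> {0..s} \<Longrightarrow> 0 \<le> f r" "integral {0..s} f = 0"
    and "0 < s" "r \<in> {0..s}"
  shows "f r = 0"
  using has_integral_0_cbox_imp_0[of 0 s f r] assms
    integrable_integral[OF integrable_continuous_real[OF assms(1)]] by auto

text \<open>
  The rates \<open>\<phi> = \<eta>'\<close> of the relative state changes \<open>\<eta>\<close> that a player can
  cause by deviating only after \<open>s0\<close>. They vanish at \<open>s0\<close> itself because feedback gains
  are continuous.
\<close>

definition vanishing_tests :: "real \<Rightarrow> real \<Rightarrow> (real \<Rightarrow> real) set" where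
  "vanishing_tests s0 T = {\<phi>. continuous_on {0..T} \<phi> \<and> (\<forall>s\<in>{0..s0}. \<phi> s = 0)}"

definition primitive :: "(real \<Rightarrow> real) \<Rightarrow> real \<Rightarrow> real" where
  "primitive \<phi> s = integral {0..s} \<phi>"

lemma primitive_zero: "s \<in> {0..s0} \<Longrightarrow> \<phi> \<in> vanishing_tests s0 T \<Longrightarrow> primitive \<phi> s = 0"
  unfolding primitive_def vanishing_tests_def
  by (subst integral_cong[where g = "\<lambda>_. 0"]) auto

lemma primitive_deriv:
  "continuous_on {0..T} \<phi> \<Longrightarrow> s \<in> {0..T} \<Longrightarrow>
    (primitive \<phi> has_real_derivative \<phi> s) (at s within {0..T})"
  using integral_has_real_derivative[of 0 T \<phi> s] by (simp add: primitive_def[abs_def])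

lemma primitive_continuous:
  "continuous_on {0..T} \<phi> \<Longrightarrow> continuous_on {0..T} (primitive \<phi>)"
  by (rule DERIV_continuous_on[OF primitive_deriv])

lemma primitive_unique:
  assumes "\<And>s. s \<in> {0..T} \<Longrightarrow> (F has_real_derivative \<phi> s) (at s within {0..T})" "F 0 = 0" "s \<in> {0..T}"
  shows "primitive \<phi> s = F s"
proof -
  have "(\<phi> has_integral F s - F 0) {0..s}"
  proof (rule fundamental_theorem_of_calculus)
    fix r assume "r \<in> {0..s}"
    then show "(F has_vector_derivative \<phi> r) (at r within {0..s})"
      using assms(1)[of r] assms(3)
      by (auto simp: has_real_derivative_iff_has_vector_derivative[symmetric]
          intro: DERIV_subset)
  qed (use assms(3) in auto)
  then show ?thesis using assms(2) by (simp add: primitive_def integral_unique)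
qed

text \<open>
  The standard weight: multiplying a continuous function by it gives a test function, and it is
  positive at each later time.
\<close>

abbreviation ramp :: "real \<Rightarrow> real \<Rightarrow> real" where
  "ramp s0 s \<equiv> max 0 (s - s0)"

lemma ramp_test: "continuous_on {0..T} f \<Longrightarrow> (\<lambda>s. ramp s0 s * f s) \<in> vanishing_tests s0 T"
  unfolding vanishing_tests_def by (auto intro!: continuous_intros)

lemma ramp_square_zero:
  fixes w f :: "real \<Rightarrow> real"
  assumes s0: "0 \<le> s0" and w: "continuous_on {0..T} w" "\<And>s. s \<in> {s0<..T} \<Longrightarrow> 0 < w s" "\<And>s. s \<in> {0..T} \<Longrightarrow> 0 \<le> w s"
    and f: "continuous_on {0..T} f" and zero: "integral {0..T} (\<lambda>s. w s * (f s)\<^sup>2) = 0" and s: "s \<in> {s0<..T}"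
  shows "f s = 0"
proof -
  have "w s * (f s)\<^sup>2 = 0"
  proof (rule nonneg_integral_zero[where s = T and f = "\<lambda>s. w s * (f s)\<^sup>2"])
    show "continuous_on {0..T} (\<lambda>s. w s * (f s)\<^sup>2)" by (intro continuous_intros w f)
  qed (use s s0 w(3) zero in auto)
  then show ?thesis using w(2)[OF s] by simp
qed

lemma primitive_pos:
  assumes s0: "0 \<le> s0" and f: "continuous_on {0..s} f" "\<And>r. r \<in> {s0<..<s} \<Longrightarrow> 0 < f r" "\<And>r. r \<in> {0..s} \<Longrightarrow> 0 \<le> f r"
    and s: "s0 < s"
  shows "0 < primitive f s"
proof -
  have "0 \<le> primitive f s"
    unfolding primitive_def by (intro integral_nonneg integrable_continuous_real f)
  moreover have "primitive f s \<noteq> 0"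
  proof
    assume "primitive f s = 0"
    then have "f ((s0 + s) / 2) = 0"
      using s s0 by (intro nonneg_integral_zero[OF f(1,3)]) (auto simp: primitive_def)
    then show False using f(2)[of "(s0 + s) / 2"] s by (auto simp: field_simps)
  qed
  ultimately show ?thesis by simp
qed

lemma continuous_zero_closure:
  fixes f :: "real \<Rightarrow> 'b::real_normed_vector"
  assumes "0 < T" "continuous_on {0..T} f" "\<And>s. s \<in> {0<..<T} \<Longrightarrow> f s = 0" "s \<in> {0..T}"
  shows "f s = 0"
  using assms continuous_constant_on_closure[of "{0<..<T}" f 0 s] by simp

text \<open>
  Scaling \<open>\<phi>\<close> by \<open>\<plusminus> e\<close> separates the linear part \<open>F\<close> from the quadratic part
  \<open>S\<close>, so both vanish, also for large \<open>\<phi>\<close>. The primitive of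
  \<open>2 \<eta> \<phi>\<close> is \<open>\<eta>\<^sup>2\<close>; the linear part at this test function is the whole
  quadratic part up to the term \<open>\<integral> \<phi>\<^sup>2 m\<close>, which is therefore zero.
\<close>

lemma deviation_expansion:
  fixes q l m :: "real \<Rightarrow> real"
  assumes s0: "0 \<le> s0" "s0 < T"
    and q: "continuous_on {0..T} q" and l: "continuous_on {0..T} l" and m: "continuous_on {0..T} m"
    and identity: "\<And>\<phi>. \<phi> \<in> vanishing_tests s0 T \<Longrightarrow> (\<And>s. s \<in> {0..T} \<Longrightarrow> \<bar>primitive \<phi> s\<bar> < 1) \<Longrightarrow>
      integral {0..T} (\<lambda>s. ((1 + primitive \<phi> s)\<^sup>2 - 1) * q s + 2 * (1 + primitive \<phi> s) * \<phi> s * l s + (\<phi> s)\<^sup>2 * m s)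
        + ((1 + primitive \<phi> T)\<^sup>2 - 1) * g = 0"
  shows "\<And>\<phi>. \<phi> \<in> vanishing_tests s0 T \<Longrightarrow>
      integral {0..T} (\<lambda>s. primitive \<phi> s * q s + \<phi> s * l s) + primitive \<phi> T * g = 0"
    and "\<And>s. s \<in> {s0<..T} \<Longrightarrow> m s = 0"
proof -
  define F where "F \<phi> = integral {0..T} (\<lambda>s. primitive \<phi> s * q s + \<phi> s * l s) + primitive \<phi> T * g" for \<phi>
  define S where "S \<phi> = integral {0..T} (\<lambda>s. (primitive \<phi> s)\<^sup>2 * q s + 2 * primitive \<phi> s * \<phi> s * l s + (\<phi> s)\<^sup>2 * m s)
     + (primitive \<phi> T)\<^sup>2 * g" for \<phi>
  have both: "F \<phi> = 0 \<and> S \<phi> = 0" if \<phi>: "\<phi> \<in> vanishing_tests s0 T" for \<phi>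
  proof -
    have c: "continuous_on {0..T} \<phi>" using \<phi> by (simp add: vanishing_tests_def)
    note pc = primitive_continuous[OF c]
    have scale: "2 * e * F \<phi> + e\<^sup>2 * S \<phi> = 0" if e: "\<And>s. s \<in> {0..T} \<Longrightarrow> \<bar>e * primitive \<phi> s\<bar> < 1" for e
    proof -
      have p: "primitive (\<lambda>s. e * \<phi> s) s = e * primitive \<phi> s" for s
        by (simp add: primitive_def)
      have "0 = integral {0..T} (\<lambda>s. ((1 + e * primitive \<phi> s)\<^sup>2 - 1) * q s
          + 2 * (1 + e * primitive \<phi> s) * (e * \<phi> s) * l s + (e * \<phi> s)\<^sup>2 * m s)
          + ((1 + e * primitive \<phi> T)\<^sup>2 - 1) * g"
      proof -
        have "(\<lambda>s. e * \<phi> s) \<in> vanishing_tests s0 T"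
          using \<phi> by (auto simp: vanishing_tests_def intro!: continuous_intros)
        from identity[OF this, unfolded p, OF e] show ?thesis by simp
      qed
      also have "integral {0..T} (\<lambda>s. ((1 + e * primitive \<phi> s)\<^sup>2 - 1) * q s
          + 2 * (1 + e * primitive \<phi> s) * (e * \<phi> s) * l s + (e * \<phi> s)\<^sup>2 * m s)
        = integral {0..T} (\<lambda>s. 2 * e * (primitive \<phi> s * q s + \<phi> s * l s)
          + e\<^sup>2 * ((primitive \<phi> s)\<^sup>2 * q s + 2 * primitive \<phi> s * \<phi> s * l s + (\<phi> s)\<^sup>2 * m s))"
        by (intro integral_cong) (simp add: power2_eq_square algebra_simps)
      also have "\<dots> = integral {0..T} (\<lambda>s. 2 * e * (primitive \<phi> s * q s + \<phi> s * l s))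
          + integral {0..T} (\<lambda>s. e\<^sup>2 * ((primitive \<phi> s)\<^sup>2 * q s + 2 * primitive \<phi> s * \<phi> s * l s + (\<phi> s)\<^sup>2 * m s))"
        by (intro integral_add integrable_continuous_real continuous_intros pc c q l m)
      also have "integral {0..T} (\<lambda>s. 2 * e * (primitive \<phi> s * q s + \<phi> s * l s)) = 2 * e * (F \<phi> - primitive \<phi> T * g)"
        by (simp only: integral_mult_right F_def add_diff_cancel_right')
      also have "integral {0..T} (\<lambda>s. e\<^sup>2 * ((primitive \<phi> s)\<^sup>2 * q s + 2 * primitive \<phi> s * \<phi> s * l s + (\<phi> s)\<^sup>2 * m s))
          = e\<^sup>2 * (S \<phi> - (primitive \<phi> T)\<^sup>2 * g)"
        by (simp only: integral_mult_right S_def add_diff_cancel_right')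
      finally show ?thesis by algebra
    qed
    obtain b where b: "b > 0" "\<And>s. s \<in> {0..T} \<Longrightarrow> norm (primitive \<phi> s) \<le> b"
      using compact_imp_bounded[OF compact_continuous_image[OF pc compact_Icc]] by (auto simp: bounded_pos)
    define e where "e = 1 / (2 * b)"
    have e0: "e > 0" using b by (simp add: e_def)
    have small: "\<bar>e * primitive \<phi> s\<bar> < 1" if "s \<in> {0..T}" for s
      using b(2)[OF that] b(1) by (simp add: e_def abs_mult field_simps)
    have small': "\<bar>- e * primitive \<phi> s\<bar> < 1" if "s \<in> {0..T}" for s
      using small[OF that] by simp
    have "2 * e * F \<phi> + e\<^sup>2 * S \<phi> = 0" by (rule scale[OF small])
    moreover have "2 * (- e) * F \<phi> + (- e)\<^sup>2 * S \<phi> = 0" by (rule scale[OF small'])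
    ultimately have "4 * (e * F \<phi>) = 0" "2 * (e\<^sup>2 * S \<phi>) = 0" by algebra+
    then show ?thesis using e0 by simp
  qed
  show "integral {0..T} (\<lambda>s. primitive \<phi> s * q s + \<phi> s * l s) + primitive \<phi> T * g = 0"
    if "\<phi> \<in> vanishing_tests s0 T" for \<phi>
    using both[OF that] by (simp add: F_def)
  have square: "integral {0..T} (\<lambda>s. (\<phi> s)\<^sup>2 * m s) = 0" if \<phi>: "\<phi> \<in> vanishing_tests s0 T" for \<phi>
  proof -
    have c: "continuous_on {0..T} \<phi>" using \<phi> by (simp add: vanishing_tests_def)
    note pc = primitive_continuous[OF c]
    \<comment> \<open>The derivative of the square of the primitive is again a test function.\<close>
    let ?\<chi> = "\<lambda>s. 2 * primitive \<phi> s * \<phi> s"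
    have \<chi>: "?\<chi> \<in> vanishing_tests s0 T"
      using \<phi> by (auto simp: vanishing_tests_def intro!: continuous_intros pc)
    have p: "primitive ?\<chi> s = (primitive \<phi> s)\<^sup>2" if "s \<in> {0..T}" for s
    proof (rule primitive_unique[OF _ _ that])
      show "((\<lambda>s. (primitive \<phi> s)\<^sup>2) has_real_derivative ?\<chi> r) (at r within {0..T})" if "r \<in> {0..T}" for r
        using primitive_deriv[OF c that] by (auto intro!: derivative_eq_intros)
    qed (simp add: primitive_def)
    have "F ?\<chi> = integral {0..T} (\<lambda>s. (primitive \<phi> s)\<^sup>2 * q s + 2 * primitive \<phi> s * \<phi> s * l s) + (primitive \<phi> T)\<^sup>2 * g"
    proof -
      have "integral {0..T} (\<lambda>s. primitive ?\<chi> s * q s + ?\<chi> s * l s)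
        = integral {0..T} (\<lambda>s. (primitive \<phi> s)\<^sup>2 * q s + 2 * primitive \<phi> s * \<phi> s * l s)"
        by (intro integral_cong) (simp only: p)
      then show ?thesis unfolding F_def using s0 p[of T] by simp
    qed
    moreover have "S \<phi> = integral {0..T} (\<lambda>s. (primitive \<phi> s)\<^sup>2 * q s + 2 * primitive \<phi> s * \<phi> s * l s)
        + integral {0..T} (\<lambda>s. (\<phi> s)\<^sup>2 * m s) + (primitive \<phi> T)\<^sup>2 * g"
    proof -
      have "integral {0..T} (\<lambda>s. ((primitive \<phi> s)\<^sup>2 * q s + 2 * primitive \<phi> s * \<phi> s * l s) + (\<phi> s)\<^sup>2 * m s)
        = integral {0..T} (\<lambda>s. (primitive \<phi> s)\<^sup>2 * q s + 2 * primitive \<phi> s * \<phi> s * l s)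
        + integral {0..T} (\<lambda>s. (\<phi> s)\<^sup>2 * m s)"
        by (intro integral_add integrable_continuous_real continuous_intros pc c q l m)
      then show ?thesis unfolding S_def by simp
    qed
    ultimately show ?thesis using both[OF \<phi>] both[OF \<chi>] by simp
  qed
  fix s assume s: "s \<in> {s0<..T}"
  \<comment> \<open>Polarisation: \<open>(1 + m)\<^sup>2 m - (1 - m)\<^sup>2 m = 4 m\<^sup>2\<close> turns the weighted integrals of \<open>m\<close>, whose sign is unknown, into one of \<open>m\<^sup>2\<close>.\<close>
  have c: "continuous_on {0..T} (\<lambda>s. 1 + m s)" "continuous_on {0..T} (\<lambda>s. 1 - m s)"
    by (intro continuous_intros m)+
  have "integral {0..T} (\<lambda>s. (ramp s0 s * (1 + m s))\<^sup>2 * m s) - integral {0..T} (\<lambda>s. (ramp s0 s * (1 - m s))\<^sup>2 * m s) = 0"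
    using square[OF ramp_test[OF c(1)]] square[OF ramp_test[OF c(2)]] by simp
  moreover have "integral {0..T} (\<lambda>s. (ramp s0 s * (1 + m s))\<^sup>2 * m s) - integral {0..T} (\<lambda>s. (ramp s0 s * (1 - m s))\<^sup>2 * m s)
    = integral {0..T} (\<lambda>s. (ramp s0 s * (1 + m s))\<^sup>2 * m s - (ramp s0 s * (1 - m s))\<^sup>2 * m s)"
    by (intro integral_diff[symmetric] integrable_continuous_real continuous_intros m)
  moreover have "(r * (1 + x))\<^sup>2 * x - (r * (1 - x))\<^sup>2 * x = (2 * r)\<^sup>2 * x\<^sup>2" for r x :: real
    by algebra
  ultimately have zero: "integral {0..T} (\<lambda>s. (2 * ramp s0 s)\<^sup>2 * (m s)\<^sup>2) = 0"
    by simp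
  show "m s = 0"
    by (rule ramp_square_zero[OF s0(1) _ _ _ m zero s]) (auto intro!: continuous_intros)
qed

text \<open>
  The coefficients of the polynomial in the amplitude of \<open>\<rho>\<close> vanish separately. In the linear
  one, \<open>\<rho>\<close> is arbitrary, so \<open>2 \<eta> a + \<phi> c\<close> vanishes pointwise for every test
  function; at a given time the values of \<open>\<eta>\<close> and \<open>\<phi>\<close> can be chosen independently.
\<close>

lemma first_order_expansion:
  fixes q l a b c :: "real \<Rightarrow> real"
  assumes s0: "0 \<le> s0" "s0 < T"
    and q: "continuous_on {0..T} q" and l: "continuous_on {0..T} l"
    and a: "continuous_on {0..T} a" and b: "continuous_on {0..T} b" and c: "continuous_on {0..T} c"
    and identity: "\<And>\<phi> \<rho>. \<phi> \<in> vanishing_tests s0 T \<Longrightarrow> continuous_on {0..T} \<rho> \<Longrightarrow>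
      integral {0..T} (\<lambda>s. primitive \<phi> s * (q s + 2 * \<rho> s * a s + (\<rho> s)\<^sup>2 * b s) + \<phi> s * (l s + \<rho> s * c s))
        + primitive \<phi> T * g = 0"
    and s: "s \<in> {s0<..T}"
  shows "b s = 0" "c s = 0"
proof -
  have parts: "integral {0..T} (\<lambda>s. primitive \<phi> s * (\<rho> s)\<^sup>2 * b s) = 0"
    "integral {0..T} (\<lambda>s. \<rho> s * (2 * primitive \<phi> s * a s + \<phi> s * c s)) = 0"
    if \<phi>: "\<phi> \<in> vanishing_tests s0 T" and \<rho>: "continuous_on {0..T} \<rho>" for \<phi> \<rho>
  proof -
    have \<phi>c: "continuous_on {0..T} \<phi>" using \<phi> by (simp add: vanishing_tests_def)
    note pc = primitive_continuous[OF \<phi>c]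
    define I0 where "I0 = integral {0..T} (\<lambda>s. primitive \<phi> s * q s + \<phi> s * l s) + primitive \<phi> T * g"
    define I1 where "I1 = integral {0..T} (\<lambda>s. \<rho> s * (2 * primitive \<phi> s * a s + \<phi> s * c s))"
    define I2 where "I2 = integral {0..T} (\<lambda>s. primitive \<phi> s * (\<rho> s)\<^sup>2 * b s)"
    have "I0 + e * I1 + e\<^sup>2 * I2 = 0" for e
    proof -
      have "0 = integral {0..T} (\<lambda>s. primitive \<phi> s * (q s + 2 * (e * \<rho> s) * a s + (e * \<rho> s)\<^sup>2 * b s)
          + \<phi> s * (l s + (e * \<rho> s) * c s)) + primitive \<phi> T * g"
        by (rule identity[symmetric, OF \<phi>]) (intro continuous_intros \<rho>)
      also have "integral {0..T} (\<lambda>s. primitive \<phi> s * (q s + 2 * (e * \<rho> s) * a s + (e * \<rho> s)\<^sup>2 * b s)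
          + \<phi> s * (l s + (e * \<rho> s) * c s))
        = integral {0..T} (\<lambda>s. (primitive \<phi> s * q s + \<phi> s * l s)
            + e * (\<rho> s * (2 * primitive \<phi> s * a s + \<phi> s * c s)) + e\<^sup>2 * (primitive \<phi> s * (\<rho> s)\<^sup>2 * b s))"
        by (intro integral_cong) (simp add: power2_eq_square algebra_simps)
      also have "\<dots> = integral {0..T} (\<lambda>s. (primitive \<phi> s * q s + \<phi> s * l s)
            + e * (\<rho> s * (2 * primitive \<phi> s * a s + \<phi> s * c s))) + integral {0..T} (\<lambda>s. e\<^sup>2 * (primitive \<phi> s * (\<rho> s)\<^sup>2 * b s))"
        by (intro integral_add integrable_continuous_real continuous_intros pc \<phi>c q l a b c \<rho>)
      also have "integral {0..T} (\<lambda>s. (primitive \<phi> s * q s + \<phi> s * l s)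
            + e * (\<rho> s * (2 * primitive \<phi> s * a s + \<phi> s * c s)))
          = integral {0..T} (\<lambda>s. primitive \<phi> s * q s + \<phi> s * l s)
            + integral {0..T} (\<lambda>s. e * (\<rho> s * (2 * primitive \<phi> s * a s + \<phi> s * c s)))"
        by (intro integral_add integrable_continuous_real continuous_intros pc \<phi>c q l a b c \<rho>)
      finally show ?thesis by (simp add: I0_def I1_def I2_def)
    qed
    from this[of 0] this[of 1] this[of "-1"] have "I1 = 0" "I2 = 0" by auto
    then show "integral {0..T} (\<lambda>s. primitive \<phi> s * (\<rho> s)\<^sup>2 * b s) = 0"
      "integral {0..T} (\<lambda>s. \<rho> s * (2 * primitive \<phi> s * a s + \<phi> s * c s)) = 0"
      by (simp_all add: I1_def I2_def)
  qed
  have ramp: "ramp s0 \<in> vanishing_tests s0 T"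
    using ramp_test[of T "\<lambda>_. 1" s0] by (simp add: continuous_intros)
  have rc: "continuous_on S (ramp s0)" for S by (intro continuous_intros)
  have pos: "0 < primitive (ramp s0) r" if "r \<in> {s0<..T}" for r
    using that s0 by (intro primitive_pos[of s0]) (auto intro!: continuous_intros)
  have nonneg: "0 \<le> primitive (ramp s0) r" for r
    unfolding primitive_def by (intro integral_nonneg integrable_continuous_real continuous_intros) auto
  show "b s = 0"
  proof -
    \<comment> \<open>The same polarisation, now in \<open>\<rho>\<close>.\<close>
    have c: "continuous_on {0..T} (\<lambda>s. 1 + b s)" "continuous_on {0..T} (\<lambda>s. 1 - b s)"
      by (intro continuous_intros b)+
    have "integral {0..T} (\<lambda>s. primitive (ramp s0) s * (1 + b s)\<^sup>2 * b s)
        - integral {0..T} (\<lambda>s. primitive (ramp s0) s * (1 - b s)\<^sup>2 * b s) = 0"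
      using parts(1)[OF ramp c(1)] parts(1)[OF ramp c(2)] by simp
    moreover have "integral {0..T} (\<lambda>s. primitive (ramp s0) s * (1 + b s)\<^sup>2 * b s)
        - integral {0..T} (\<lambda>s. primitive (ramp s0) s * (1 - b s)\<^sup>2 * b s)
      = integral {0..T} (\<lambda>s. primitive (ramp s0) s * (1 + b s)\<^sup>2 * b s - primitive (ramp s0) s * (1 - b s)\<^sup>2 * b s)"
      by (intro integral_diff[symmetric] integrable_continuous_real continuous_intros primitive_continuous rc b)
    moreover have "p * (1 + x)\<^sup>2 * x - p * (1 - x)\<^sup>2 * x = (4 * p) * x\<^sup>2" for p x :: real
      by algebra
    ultimately have zero: "integral {0..T} (\<lambda>s. (4 * primitive (ramp s0) s) * (b s)\<^sup>2) = 0"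
      by simp
    show ?thesis
      by (rule ramp_square_zero[OF s0(1) _ _ _ b zero s])
         (use pos nonneg in \<open>auto intro!: continuous_intros primitive_continuous rc\<close>)
  qed
  have pointwise: "2 * primitive \<phi> s * a s + \<phi> s * c s = 0" if \<phi>: "\<phi> \<in> vanishing_tests s0 T" for \<phi>
  proof -
    have \<phi>c: "continuous_on {0..T} \<phi>" using \<phi> by (simp add: vanishing_tests_def)
    \<comment> \<open>Choosing \<open>\<rho>\<close> as the other factor makes the integrand a square.\<close>
    let ?f = "\<lambda>s. 2 * primitive \<phi> s * a s + \<phi> s * c s"
    have f: "continuous_on {0..T} ?f"
      by (intro continuous_intros primitive_continuous \<phi>c a c)
    from parts(2)[OF \<phi> f] have "integral {0..T} (\<lambda>s. 1 * (?f s)\<^sup>2) = 0"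
      by (simp add: power2_eq_square)
    from ramp_square_zero[OF s0(1) continuous_on_const _ _ f this s] show ?thesis by simp
  qed
  have "a s = 0"
  proof -
    \<comment> \<open>A test function that is zero at \<open>s\<close> while its primitive is positive there.\<close>
    let ?\<phi> = "\<lambda>r. ramp s0 r * (s - r)"
    have "0 < primitive ?\<phi> s"
      using s s0 by (intro primitive_pos[of s0]) (auto intro!: continuous_intros mult_nonneg_nonneg)
    moreover have "2 * primitive ?\<phi> s * a s = 0"
      using pointwise[of ?\<phi>] ramp_test[of T "\<lambda>r. s - r" s0] by (simp add: continuous_intros)
    ultimately show ?thesis by simp
  qed
  then show "c s = 0"
    using pointwise[OF ramp] s by simp
qed

text \<open>
  Integration by parts turns the hypothesis into \<open>\<integral> \<phi> V = 0\<close>, where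
  \<open>V s = g + \<integral>\<^sub>s\<^sup>T q\<close>. Hence \<open>V = 0\<close> after \<open>s0\<close>, and both claims
  are read off: \<open>g = V T\<close> and \<open>q = - V'\<close>.
\<close>

lemma weak_integral_zero:
  fixes q :: "real \<Rightarrow> real"
  assumes s0: "0 \<le> s0" "s0 < T" and q: "continuous_on {0..T} q"
    and identity: "\<And>\<phi>. \<phi> \<in> vanishing_tests s0 T \<Longrightarrow>
      integral {0..T} (\<lambda>s. primitive \<phi> s * q s) + primitive \<phi> T * g = 0"
  shows "g = 0" "\<And>s. s \<in> {s0<..<T} \<Longrightarrow> q s = 0"
proof -
  define V where "V s = primitive q T - primitive q s + g" for s
  have Vc: "continuous_on {0..T} V"
    unfolding V_def by (intro continuous_intros primitive_continuous q)
  have dV: "(V has_real_derivative - q s) (at s within {0..T})" if "s \<in> {0..T}" for s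
    unfolding V_def using primitive_deriv[OF q that] by (auto intro!: derivative_eq_intros)
  \<comment> \<open>Testing with \<open>V\<close> itself, weighted, makes \<open>\<integral> \<phi> V\<close> a weighted square.\<close>
  let ?\<phi> = "\<lambda>s. ramp s0 s * V s"
  have \<phi>: "?\<phi> \<in> vanishing_tests s0 T" by (rule ramp_test[OF Vc])
  then have \<phi>c: "continuous_on {0..T} ?\<phi>" by (simp add: vanishing_tests_def)
  note pc = primitive_continuous[OF \<phi>c]
  have "primitive (\<lambda>s. ?\<phi> s * V s - primitive ?\<phi> s * q s) T = primitive ?\<phi> T * V T"
  proof (rule primitive_unique)
    show "((\<lambda>s. primitive ?\<phi> s * V s) has_real_derivative ?\<phi> s * V s - primitive ?\<phi> s * q s) (at s within {0..T})"
      if "s \<in> {0..T}" for s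
      using DERIV_mult[OF primitive_deriv[OF \<phi>c that] dV[OF that]] by (simp add: algebra_simps)
  qed (use s0 in \<open>auto simp: primitive_def\<close>)
  moreover have "primitive (\<lambda>s. ?\<phi> s * V s - primitive ?\<phi> s * q s) T
      = integral {0..T} (\<lambda>s. ?\<phi> s * V s) - integral {0..T} (\<lambda>s. primitive ?\<phi> s * q s)"
    unfolding primitive_def[of "\<lambda>s. ?\<phi> s * V s - primitive ?\<phi> s * q s"]
    by (intro integral_diff integrable_continuous_real continuous_intros Vc pc q)
  ultimately have "integral {0..T} (\<lambda>s. ?\<phi> s * V s) = 0"
    using identity[OF \<phi>] by (simp add: V_def)
  then have "integral {0..T} (\<lambda>s. ramp s0 s * (V s)\<^sup>2) = 0"
    by (simp add: power2_eq_square mult.assoc)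
  from ramp_square_zero[OF s0(1) _ _ _ Vc this] have V0: "V s = 0" if "s \<in> {s0<..T}" for s
    using that by (simp add: continuous_intros)
  from V0[of T] s0 show "g = 0" by (simp add: V_def)
  fix s assume s: "s \<in> {s0<..<T}"
  then have "at s within {0..T} = at s"
    using s0 by (intro at_within_Icc_at) auto
  then have "(V has_real_derivative - q s) (at s)"
    using dV[of s] s s0 by simp
  moreover have "((\<lambda>_. 0) has_real_derivative 0) (at s)" by simp
  then have "(V has_real_derivative 0) (at s)"
    by (rule has_field_derivative_transform_within_open[of _ _ _ "{s0<..<T}"]) (use s V0 in auto)
  ultimately have "- q s = 0" by (rule DERIV_unique)
  then show "q s = 0" by simp
qed

section \<open>Profiles of linear policies and potential games\<close>

definition gain_profile :: "('a::finite \<Rightarrow> 'i) \<Rightarrow> real \<Rightarrow> (real \<Rightarrow> real^'n^'a) \<Rightarrow> 'i \<Rightarrow> real \<times> (real^'n) \<Rightarrow> real^'a" where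
  "gain_profile own T K j =
     restrict (\<lambda>(t, x). (\<chi> c. if own c = j then K t $ c else 0) *v x) ({0..T} \<times> UNIV)"

lemma gain_profile_linear:
  assumes "continuous_on {0..T} K"
  shows "gain_profile own T K j \<in> linear_policies own T j"
proof -
  let ?K = "\<lambda>t. (\<chi> c. if own c = j then K t $ c else 0)"
  have "continuous_on {0..T} (\<lambda>t. if own c = j then K t $ c else 0)" for c
    by (cases "own c = j") (auto intro!: continuous_on_component assms)
  then have "continuous_on {0..T} ?K"
    by (intro continuous_on_vec_lambda)
  then show ?thesis
    unfolding linear_policies_def gain_profile_def by (intro CollectI exI[of _ ?K]) auto
qed

lemma joint_gain_profile:
  assumes "s \<in> {0..T}"
  shows "joint_policy own (gain_profile own T K) (s, y) = K s *v y"
  using assms by (simp add: joint_policy_def gain_profile_def vec_eq_iff matrix_vector_mult_def)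

lemma gain_profile_update:
  assumes "\<And>s c. own c \<noteq> i \<Longrightarrow> K' s $ c = K s $ c"
  shows "(gain_profile own T K)(i := gain_profile own T K' i) = gain_profile own T K'"
proof
  fix j
  have "(\<chi> c. if own c = j then K t $ c else 0) = (\<chi> c. if own c = j then K' t $ c else 0)" if "j \<noteq> i" for t
    using assms that by (auto simp: vec_eq_iff)
  then show "((gain_profile own T K)(i := gain_profile own T K' i)) j = gain_profile own T K' j"
    by (auto simp: gain_profile_def)
qed

text \<open>
  Going around the square of the four profiles, the potential changes by increments of \<open>V i\<close>
  along two sides and by increments of \<open>V j\<close> along the other two.
\<close>

lemma potential_mixed_difference:
  assumes mpg: "markov_potential_game S \<pi> V" and z: "z \<in> S" and ij: "i \<noteq> j"
    and \<phi>: "\<And>k. \<phi> k \<in> \<pi> k" and p: "p \<in> \<pi> i" and q: "q \<in> \<pi> j"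
  defines "D \<equiv> \<lambda>\<phi>. V i \<phi> z - V j \<phi> z"
  shows "D (\<phi>(j := q, i := p)) - D (\<phi>(j := q)) - D (\<phi>(i := p)) + D \<phi> = 0"
proof -
  obtain \<Phi> where \<Phi>: "\<And>k \<phi> p. (\<forall>j. \<phi> j \<in> \<pi> j) \<Longrightarrow> p \<in> \<pi> k \<Longrightarrow>
      \<Phi> z (\<phi>(k := p)) - \<Phi> z \<phi> = V k (\<phi>(k := p)) z - V k \<phi> z"
    using mpg z unfolding markov_potential_game_def by blast
  have "\<Phi> z (\<phi>(i := p)) - \<Phi> z \<phi> = V i (\<phi>(i := p)) z - V i \<phi> z"
    "\<Phi> z (\<phi>(j := q)) - \<Phi> z \<phi> = V j (\<phi>(j := q)) z - V j \<phi> z"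
    "\<Phi> z (\<phi>(j := q, i := p)) - \<Phi> z (\<phi>(j := q)) = V i (\<phi>(j := q, i := p)) z - V i (\<phi>(j := q)) z"
    "\<Phi> z (\<phi>(i := p, j := q)) - \<Phi> z (\<phi>(i := p)) = V j (\<phi>(i := p, j := q)) z - V j (\<phi>(i := p)) z"
    by (rule \<Phi>; use \<phi> p q in auto)+
  moreover have "\<phi>(i := p, j := q) = \<phi>(j := q, i := p)"
    using ij by (rule fun_upd_twist)
  ultimately show ?thesis by (simp add: D_def)
qed

section \<open>Comparing the costs of two players\<close>

locale lq_potential_pair =
  fixes T :: real
    and own :: "'a::finite \<Rightarrow> 'i"
    and A :: "real \<Rightarrow> real^'n^'n"
    and B :: "real \<Rightarrow> real^'a^'n"
    and \<sigma> :: "real^'m^'n"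
    and Q :: "'i \<Rightarrow> real \<Rightarrow> real^'n^'n"
    and R :: "'i \<Rightarrow> real \<Rightarrow> real^'a^'a"
    and G :: "'i \<Rightarrow> real^'n^'n"
    and M :: "'w measure"
    and W :: "real \<Rightarrow> 'w \<Rightarrow> real^'m"
    and i j :: 'i
  assumes T: "T > 0"
    and A: "continuous_on {0..T} A"
    and B: "continuous_on {0..T} B"
    and Q: "\<And>k. continuous_on {0..T} (Q k)"
    and Q_sym: "\<And>k t. t \<in> {0..T} \<Longrightarrow> transpose (Q k t) = Q k t"
    and R: "\<And>k. continuous_on {0..T} (R k)"
    and R_sym: "\<And>k t. t \<in> {0..T} \<Longrightarrow> transpose (R k t) = R k t"
    and G_sym: "\<And>k. transpose (G k) = G k"
    and bm: "standard_brownian_motion M T W"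
    and rank: "\<And>k t. t \<in> {0..T} \<Longrightarrow> full_row_rank (col_block own k (B t))"
    and mpg: "markov_potential_game ({0..T} \<times> UNIV) (linear_policies own T)
           (lq_value M W T own A B \<sigma> Q R G)"
    and ij: "i \<noteq> j"
begin

definition Qd where "Qd s = Q i s - Q j s"
definition Rd where "Rd s = R i s - R j s"
definition Gd where "Gd = G i - G j"

lemma Qd: "continuous_on {0..T} Qd" and Rd: "continuous_on {0..T} Rd"
  unfolding Qd_def Rd_def by (intro continuous_intros Q R)+

lemma Rd_commute: "s \<in> {0..T} \<Longrightarrow> p \<bullet> (Rd s *v q) = q \<bullet> (Rd s *v p)"
  by (metis R_sym Rd_def inner_commute inner_matrix_transpose transpose_diff)

text \<open>
  The deterministic part of \<open>V i - V j\<close> for a profile that multiplies the state by \<open>h\<close>.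
\<close>

definition gap_cost :: "(real \<Rightarrow> real) \<Rightarrow> (real \<Rightarrow> real^'n^'a) \<Rightarrow> real^'n \<Rightarrow> real" where
  "gap_cost h K x = integral {0..T} (\<lambda>s. (h s)\<^sup>2 * (x \<bullet> (closed_loop_weight Qd Rd K s *v x)))
     + (h T)\<^sup>2 * (x \<bullet> (Gd *v x))"

text \<open>
  With this gain the noise-free state started at \<open>x\<close> is \<open>h s x\<close>.
\<close>

definition steers :: "(real \<Rightarrow> real^'n^'a) \<Rightarrow> (real \<Rightarrow> real) \<Rightarrow> (real \<Rightarrow> real) \<Rightarrow> bool" where
  "steers K h h' \<longleftrightarrow> continuous_on {0..T} K \<and> continuous_on {0..T} h' \<and> h 0 = 1 \<and>
     (\<forall>s\<in>{0..T}. (h has_real_derivative h' s) (at s within {0..T}) \<and> 0 < h s \<and>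
        A s + B s ** K s = (h' s / h s) *\<^sub>R mat 1)"

abbreviation value_gap where
  "value_gap K z \<equiv> lq_value M W T own A B \<sigma> Q R G i (gain_profile own T K) z
     - lq_value M W T own A B \<sigma> Q R G j (gain_profile own T K) z"

lemma value_gap_second_difference:
  assumes "steers K h h'"
  shows "value_gap K (0, x) + value_gap K (0, - x) - 2 * value_gap K (0, 0) = gap_cost h K x"
proof -
  have K: "continuous_on {0..T} K" and h': "continuous_on {0..T} h'" and h0: "h 0 = 1"
    and h: "\<And>s. s \<in> {0..T} \<Longrightarrow> (h has_real_derivative h' s) (at s within {0..T})"
    and pos: "\<And>s. s \<in> {0..T} \<Longrightarrow> 0 < h s"
    and loop: "\<And>s. s \<in> {0..T} \<Longrightarrow> A s + B s ** K s = (h' s / h s) *\<^sub>R mat 1"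
    using assms by (auto simp: steers_def)
  have hc: "continuous_on {0..T} h" using h by (rule DERIV_continuous_on)
  let ?w = "\<lambda>k s. (h s)\<^sup>2 * (x \<bullet> (closed_loop_weight (Q k) (R k) K s *v x))"
  have second: "lq_value M W T own A B \<sigma> Q R G k (gain_profile own T K) (0, x)
      + lq_value M W T own A B \<sigma> Q R G k (gain_profile own T K) (0, - x)
      - 2 * lq_value M W T own A B \<sigma> Q R G k (gain_profile own T K) (0, 0)
    = integral {0..T} (?w k) + (h T)\<^sup>2 * (x \<bullet> (G k *v x))" for k
    by (rule lq_value_second_difference[OF bm T h pos h0 h' loop joint_gain_profile Q R K])
  have "integral {0..T} (?w i) - integral {0..T} (?w j) = integral {0..T} (\<lambda>s. ?w i s - ?w j s)"
    by (intro integral_diff[symmetric] integrable_continuous_real continuous_intros hc Q R K)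
  also have "\<dots> = integral {0..T} (\<lambda>s. (h s)\<^sup>2 * (x \<bullet> (closed_loop_weight Qd Rd K s *v x)))"
    by (intro integral_cong)
       (simp add: closed_loop_weight_form Qd_def Rd_def matrix_vector_mult_diff_rdistrib inner_diff_right algebra_simps)
  finally show ?thesis
    using second[of i] second[of j]
    by (simp add: gap_cost_def Gd_def matrix_vector_mult_diff_rdistrib inner_diff_right algebra_simps)
qed

lemma gap_cost_mixed_difference:
  assumes s: "steers K h h'" "steers (\<lambda>s. K s + Hi s) hi hi'" "steers (\<lambda>s. K s + Hj s) hj hj'"
    "steers (\<lambda>s. K s + Hi s + Hj s) hij hij'"
    and rows: "\<And>s c. own c \<noteq> i \<Longrightarrow> Hi s $ c = 0" "\<And>s c. own c \<noteq> j \<Longrightarrow> Hj s $ c = 0"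
  shows "gap_cost hij (\<lambda>s. K s + Hi s + Hj s) x - gap_cost hj (\<lambda>s. K s + Hj s) x
     - gap_cost hi (\<lambda>s. K s + Hi s) x + gap_cost h K x = 0"
proof -
  have cont: "continuous_on {0..T} K" "continuous_on {0..T} (\<lambda>s. K s + Hi s)"
    "continuous_on {0..T} (\<lambda>s. K s + Hj s)" "continuous_on {0..T} (\<lambda>s. K s + Hi s + Hj s)"
    using s by (auto simp: steers_def)
  let ?P = "gain_profile own T"
  have upd: "(?P K)(i := ?P (\<lambda>s. K s + Hi s) i) = ?P (\<lambda>s. K s + Hi s)"
    "(?P K)(j := ?P (\<lambda>s. K s + Hj s) j) = ?P (\<lambda>s. K s + Hj s)"
    "(?P (\<lambda>s. K s + Hj s))(i := ?P (\<lambda>s. K s + Hi s) i) = ?P (\<lambda>s. K s + Hi s + Hj s)"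
  proof -
    show "(?P K)(i := ?P (\<lambda>s. K s + Hi s) i) = ?P (\<lambda>s. K s + Hi s)"
      "(?P K)(j := ?P (\<lambda>s. K s + Hj s) j) = ?P (\<lambda>s. K s + Hj s)"
      by (rule gain_profile_update; simp add: rows)+
    have "(\<chi> c. if own c = i then (K t + Hi t) $ c else 0)
      = (\<chi> c. if own c = i then (K t + Hi t + Hj t) $ c else 0)" for t
      using rows(2) ij by (auto simp: vec_eq_iff)
    then have "?P (\<lambda>s. K s + Hi s) i = ?P (\<lambda>s. K s + Hi s + Hj s) i"
      by (simp add: gain_profile_def)
    then show "(?P (\<lambda>s. K s + Hj s))(i := ?P (\<lambda>s. K s + Hi s) i) = ?P (\<lambda>s. K s + Hi s + Hj s)"
      by (simp only:) (rule gain_profile_update, simp add: rows)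
  qed
  define v where "v K y = value_gap K (0, y)" for K y
  have "v (\<lambda>s. K s + Hi s + Hj s) y - v (\<lambda>s. K s + Hj s) y - v (\<lambda>s. K s + Hi s) y + v K y = 0" for y
  proof -
    have "(0, y) \<in> {0..T} \<times> UNIV" using T by simp
    from potential_mixed_difference[OF mpg this ij gain_profile_linear[OF cont(1)]
        gain_profile_linear[OF cont(2)] gain_profile_linear[OF cont(3)]]
    show ?thesis unfolding upd v_def .
  qed
  from this[of x] this[of "- x"] this[of 0] show ?thesis
    unfolding s[THEN value_gap_second_difference, symmetric, folded v_def] by linarith
qed

text \<open>
  Player \<open>j\<close> multiplies the state by \<open>\<alpha>\<close>, which grows on \<open>[0, s0]\<close> and is constant
  afterwards, and player \<open>i\<close> multiplies it by \<open>\<beta> = 1 + \<eta>\<close>, which is one up to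
  \<open>s0\<close>. Before \<open>s0\<close> the mixed difference of the running costs is zero because only
  \<open>j\<close> deviates; after \<open>s0\<close> the cost is quadratic in the state, so it is
  \<open>\<alpha>(T)\<^sup>2 - 1\<close> times the effect of \<open>i\<close> alone. Dividing by this nonzero factor leaves
  the effect of \<open>i\<close>, and the rest expands it.
\<close>

lemma deviation_identity:
  assumes K: "continuous_on {0..T} K" and loop: "\<And>s. s \<in> {0..T} \<Longrightarrow> A s + B s ** K s = 0"
    and L: "continuous_on {0..T} L" "\<And>s. s \<in> {0..T} \<Longrightarrow> B s ** L s = mat 1"
      "\<And>s c. own c \<noteq> i \<Longrightarrow> L s $ c = 0"
    and s0: "0 < s0" "s0 < T" and \<phi>: "\<phi> \<in> vanishing_tests s0 T"
    and small: "\<And>s. s \<in> {0..T} \<Longrightarrow> \<bar>primitive \<phi> s\<bar> < 1"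
  shows "integral {0..T} (\<lambda>s. ((1 + primitive \<phi> s)\<^sup>2 - 1) * (x \<bullet> (closed_loop_weight Qd Rd K s *v x))
       + 2 * (1 + primitive \<phi> s) * \<phi> s * ((L s *v x) \<bullet> (Rd s *v (K s *v x)))
       + (\<phi> s)\<^sup>2 * ((L s *v x) \<bullet> (Rd s *v (L s *v x))))
     + ((1 + primitive \<phi> T)\<^sup>2 - 1) * (x \<bullet> (Gd *v x)) = 0"
proof -
  obtain L' where L': "continuous_on {0..T} L'" "\<And>s. s \<in> {0..T} \<Longrightarrow> B s ** L' s = mat 1"
    "\<And>s c. own c \<noteq> j \<Longrightarrow> L' s $ c = 0"
    using block_right_inverse[OF B rank, of j] by blast
  have \<phi>c: "continuous_on {0..T} \<phi>" using \<phi> by (simp add: vanishing_tests_def)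
  define \<psi> where "\<psi> s = max 0 (s0 - s)" for s
  have \<psi>c: "continuous_on S \<psi>" for S unfolding \<psi>_def by (intro continuous_intros)
  define \<alpha> where "\<alpha> s = 1 + primitive \<psi> s" for s
  define \<beta> where "\<beta> s = 1 + primitive \<phi> s" for s
  have d\<alpha>: "(\<alpha> has_real_derivative \<psi> s) (at s within {0..T})"
    and d\<beta>: "(\<beta> has_real_derivative \<phi> s) (at s within {0..T})" if "s \<in> {0..T}" for s
    unfolding \<alpha>_def[abs_def] \<beta>_def[abs_def]
    using primitive_deriv[OF \<psi>c that] primitive_deriv[OF \<phi>c that] by (auto intro!: derivative_eq_intros)
  have \<alpha>c: "continuous_on {0..T} \<alpha>" by (rule DERIV_continuous_on[OF d\<alpha>])
  have \<beta>c: "continuous_on {0..T} \<beta>" by (rule DERIV_continuous_on[OF d\<beta>])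
  have "0 \<le> primitive \<psi> s" for s
    unfolding primitive_def by (intro integral_nonneg integrable_continuous_real \<psi>c) (simp add: \<psi>_def)
  then have \<alpha>pos: "0 < \<alpha> s" for s by (simp add: \<alpha>_def add_pos_nonneg)
  have \<beta>pos: "0 < \<beta> s" if "s \<in> {0..T}" for s using small[OF that] by (simp add: \<beta>_def)
  have init: "\<alpha> 0 = 1" "\<beta> 0 = 1" by (simp_all add: \<alpha>_def \<beta>_def primitive_def)
  have \<alpha>T: "\<alpha> s = \<alpha> T" if "s \<in> {s0..T}" for s
  proof -
    have "integral {0..s} \<psi> + integral {s..T} \<psi> = integral {0..T} \<psi>"
      by (rule Henstock_Kurzweil_Integration.integral_combine[OF _ _ integrable_continuous_real[OF \<psi>c]]) (use that s0 in auto)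
    moreover have "integral {s..T} \<psi> = 0"
      using that by (subst integral_cong[where g = "\<lambda>_. 0"]) (auto simp: \<psi>_def)
    ultimately show ?thesis by (simp add: \<alpha>_def primitive_def)
  qed
  have "0 < primitive \<psi> s0"
    using s0 by (intro primitive_pos[of 0] \<psi>c) (auto simp: \<psi>_def)
  then have "1 < \<alpha> T" using \<alpha>T[of s0] s0 by (simp add: \<alpha>_def)
  then have \<alpha>T1: "(\<alpha> T)\<^sup>2 - 1 \<noteq> 0" by (simp add: power2_eq_1_iff)
  define Hi where "Hi s = (\<phi> s / \<beta> s) *\<^sub>R L s" for s
  define Hj where "Hj s = (\<psi> s / \<alpha> s) *\<^sub>R L' s" for s
  have \<alpha>_ne: "\<alpha> s \<noteq> 0" for s using \<alpha>pos[of s] by simp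
  have \<beta>_ne: "\<beta> s \<noteq> 0" if "s \<in> {0..T}" for s using \<beta>pos[OF that] by simp
  have Hc: "continuous_on {0..T} Hi" "continuous_on {0..T} Hj"
  proof -
    show "continuous_on {0..T} Hi" unfolding Hi_def
      by (intro continuous_on_scaleR continuous_on_divide \<phi>c \<beta>c L(1)) (simp add: \<beta>_ne)
    show "continuous_on {0..T} Hj" unfolding Hj_def
      by (intro continuous_on_scaleR continuous_on_divide \<psi>c \<alpha>c L'(1)) (simp add: \<alpha>_ne)
  qed
  have BH: "B s ** Hi s = (\<phi> s / \<beta> s) *\<^sub>R mat 1" "B s ** Hj s = (\<psi> s / \<alpha> s) *\<^sub>R mat 1" if "s \<in> {0..T}" for s
    unfolding Hi_def Hj_def matrix_mult_scaleR L(2)[OF that] L'(2)[OF that] by (rule refl)+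
  have closed: "A s + B s ** (K s + H) = B s ** H" if "s \<in> {0..T}" for s H
    using loop[OF that] by (simp add: matrix_add_ldistrib flip: add.assoc)
  have "steers K (\<lambda>_. 1) (\<lambda>_. 0)"
    using K loop by (simp add: steers_def)
  moreover have "steers (\<lambda>s. K s + Hi s) \<beta> \<phi>"
    unfolding steers_def
    by (intro conjI ballI continuous_on_add K Hc \<phi>c init d\<beta> \<beta>pos) (simp_all add: closed BH)
  moreover have "steers (\<lambda>s. K s + Hj s) \<alpha> \<psi>"
    unfolding steers_def
    by (intro conjI ballI continuous_on_add K Hc \<psi>c init d\<alpha> \<alpha>pos) (simp_all add: closed BH)
  moreover have "steers (\<lambda>s. K s + Hi s + Hj s) (\<lambda>s. \<alpha> s * \<beta> s) (\<lambda>s. \<psi> s * \<beta> s + \<phi> s * \<alpha> s)"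
    unfolding steers_def
  proof (intro conjI ballI)
    fix s assume s: "s \<in> {0..T}"
    show "((\<lambda>s. \<alpha> s * \<beta> s) has_real_derivative \<psi> s * \<beta> s + \<phi> s * \<alpha> s) (at s within {0..T})"
      by (rule DERIV_mult[OF d\<alpha>[OF s] d\<beta>[OF s]])
    show "0 < \<alpha> s * \<beta> s" using \<alpha>pos \<beta>pos[OF s] by simp
    have "(\<psi> s * \<beta> s + \<phi> s * \<alpha> s) / (\<alpha> s * \<beta> s) = \<phi> s / \<beta> s + \<psi> s / \<alpha> s"
      using \<alpha>pos[of s] \<beta>pos[OF s] by (simp add: field_simps)
    then show "A s + B s ** (K s + Hi s + Hj s) = ((\<psi> s * \<beta> s + \<phi> s * \<alpha> s) / (\<alpha> s * \<beta> s)) *\<^sub>R mat 1"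
      by (simp only: closed[OF s, of "Hi s + Hj s", folded add.assoc] matrix_add_ldistrib[of "B s" "Hi s"] BH[OF s] scaleR_add_left)
  qed (simp_all add: init continuous_on_add continuous_on_mult K Hc \<phi>c \<psi>c \<alpha>c \<beta>c)
  ultimately have mixed: "gap_cost (\<lambda>s. \<alpha> s * \<beta> s) (\<lambda>s. K s + Hi s + Hj s) x - gap_cost \<alpha> (\<lambda>s. K s + Hj s) x
     - gap_cost \<beta> (\<lambda>s. K s + Hi s) x + gap_cost (\<lambda>_. 1) K x = 0"
    by (rule gap_cost_mixed_difference) (simp_all add: Hi_def Hj_def L(3) L'(3))
  define q where "q K s = x \<bullet> (closed_loop_weight Qd Rd K s *v x)" for K s
  have qc: "continuous_on {0..T} (q K)" if "continuous_on {0..T} K" for K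
    unfolding q_def by (intro continuous_intros Qd Rd that)
  have q_cong: "q K1 s = q K2 s" if "K1 s = K2 s" for K1 K2 s
    using that by (simp add: q_def closed_loop_weight_def)
  have early: "\<phi> s = 0" "\<beta> s = 1" "Hi s = 0" if "s \<in> {0..s0}" for s
    using \<phi> primitive_zero[OF that \<phi>] that by (auto simp: vanishing_tests_def \<beta>_def Hi_def)
  have late: "Hj s = 0" if "s0 \<le> s" for s
    using that by (simp add: Hj_def \<psi>_def)
  let ?I = "\<lambda>s. (\<beta> s)\<^sup>2 * q (\<lambda>s. K s + Hi s) s - q K s"
  have pointwise: "(\<alpha> s * \<beta> s)\<^sup>2 * q (\<lambda>s. K s + Hi s + Hj s) s - (\<alpha> s)\<^sup>2 * q (\<lambda>s. K s + Hj s) s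
      - (\<beta> s)\<^sup>2 * q (\<lambda>s. K s + Hi s) s + q K s = ((\<alpha> T)\<^sup>2 - 1) * ?I s" if s: "s \<in> {0..T}" for s
  proof (cases "s \<le> s0")
    case True
    then have e: "\<beta> s = 1" "Hi s = 0" using early[of s] s by auto
    have "q (\<lambda>s. K s + Hi s + Hj s) s = q (\<lambda>s. K s + Hj s) s" "q (\<lambda>s. K s + Hi s) s = q K s"
      by (intro q_cong; simp add: e)+
    then show ?thesis by (simp add: e)
  next
    case False
    then have "q (\<lambda>s. K s + Hi s + Hj s) s = q (\<lambda>s. K s + Hi s) s" "q (\<lambda>s. K s + Hj s) s = q K s"
      by (intro q_cong; simp add: late)+
    then show ?thesis using \<alpha>T[of s] False s by (simp add: power_mult_distrib algebra_simps)
  qed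
  have KH: "continuous_on {0..T} (\<lambda>s. K s + Hi s + Hj s)" "continuous_on {0..T} (\<lambda>s. K s + Hj s)"
    "continuous_on {0..T} (\<lambda>s. K s + Hi s)"
    by (intro continuous_intros K Hc)+
  define g where "g = x \<bullet> (Gd *v x)"
  have "((\<alpha> T)\<^sup>2 - 1) * (integral {0..T} ?I + ((\<beta> T)\<^sup>2 - 1) * g) = 0"
  proof -
    let ?a = "\<lambda>s. (\<alpha> s * \<beta> s)\<^sup>2 * q (\<lambda>s. K s + Hi s + Hj s) s" and ?b = "\<lambda>s. (\<alpha> s)\<^sup>2 * q (\<lambda>s. K s + Hj s) s"
    let ?c = "\<lambda>s. (\<beta> s)\<^sup>2 * q (\<lambda>s. K s + Hi s) s" and ?d = "q K"
    have int: "?a integrable_on {0..T}" "?b integrable_on {0..T}" "?c integrable_on {0..T}" "?d integrable_on {0..T}"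
      by (intro integrable_continuous_real continuous_intros \<alpha>c \<beta>c qc KH K)+
    have "integral {0..T} ?a - integral {0..T} ?b - integral {0..T} ?c + integral {0..T} ?d
        = integral {0..T} (\<lambda>s. ?a s - ?b s - ?c s + ?d s)"
      by (simp only: integral_add integral_diff integrable_diff int)
    also have "\<dots> = integral {0..T} (\<lambda>s. ((\<alpha> T)\<^sup>2 - 1) * ?I s)"
      by (intro integral_cong pointwise)
    finally have "integral {0..T} ?a - integral {0..T} ?b - integral {0..T} ?c + integral {0..T} ?d
       = ((\<alpha> T)\<^sup>2 - 1) * integral {0..T} ?I" by simp
    moreover have "integral {0..T} ?a - integral {0..T} ?b - integral {0..T} ?c + integral {0..T} ?d
       = - ((\<alpha> T * \<beta> T)\<^sup>2 - (\<alpha> T)\<^sup>2 - (\<beta> T)\<^sup>2 + 1) * g"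
      using mixed by (simp add: gap_cost_def g_def q_def[abs_def] algebra_simps)
    ultimately show ?thesis by (simp add: power_mult_distrib algebra_simps)
  qed
  then have "integral {0..T} ?I + ((\<beta> T)\<^sup>2 - 1) * g = 0" using \<alpha>T1 by simp
  moreover have "integral {0..T} ?I = integral {0..T} (\<lambda>s. ((\<beta> s)\<^sup>2 - 1) * q K s
      + 2 * \<beta> s * \<phi> s * ((L s *v x) \<bullet> (Rd s *v (K s *v x))) + (\<phi> s)\<^sup>2 * ((L s *v x) \<bullet> (Rd s *v (L s *v x))))"
  proof (intro integral_cong)
    fix s assume s: "s \<in> {0..T}"
    define k l where "k = K s *v x" and "l = L s *v x"
    have "q (\<lambda>s. K s + Hi s) s = q K s + 2 * (\<phi> s / \<beta> s) * (l \<bullet> (Rd s *v k)) + (\<phi> s / \<beta> s)\<^sup>2 * (l \<bullet> (Rd s *v l))"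
      using Rd_commute[OF s, of k l]
      by (simp add: q_def closed_loop_weight_form Hi_def matrix_vector_mult_add_rdistrib matrix_vector_right_distrib
          matrix_vector_mult_scaleR scaleR_matrix_vector_assoc[symmetric] inner_add_left inner_add_right
          power2_eq_square algebra_simps flip: k_def l_def)
    then show "?I s = ((\<beta> s)\<^sup>2 - 1) * q K s + 2 * \<beta> s * \<phi> s * ((L s *v x) \<bullet> (Rd s *v (K s *v x)))
       + (\<phi> s)\<^sup>2 * ((L s *v x) \<bullet> (Rd s *v (L s *v x)))"
      using \<beta>pos[OF s] by (simp add: power2_eq_square field_simps flip: k_def l_def)
  qed
  ultimately show ?thesis
    by (simp add: \<beta>_def q_def g_def)
qed

lemma first_variation:
  assumes K: "continuous_on {0..T} K" and loop: "\<And>s. s \<in> {0..T} \<Longrightarrow> A s + B s ** K s = 0"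
    and L: "continuous_on {0..T} L" "\<And>s. s \<in> {0..T} \<Longrightarrow> B s ** L s = mat 1"
      "\<And>s c. own c \<noteq> i \<Longrightarrow> L s $ c = 0"
    and s0: "0 < s0" "s0 < T"
  shows "\<And>\<phi>. \<phi> \<in> vanishing_tests s0 T \<Longrightarrow>
      integral {0..T} (\<lambda>s. primitive \<phi> s * (x \<bullet> (closed_loop_weight Qd Rd K s *v x))
        + \<phi> s * ((L s *v x) \<bullet> (Rd s *v (K s *v x)))) + primitive \<phi> T * (x \<bullet> (Gd *v x)) = 0"
    and "\<And>s. s \<in> {s0<..T} \<Longrightarrow> (L s *v x) \<bullet> (Rd s *v (L s *v x)) = 0"
proof -
  have cont: "continuous_on {0..T} (\<lambda>s. x \<bullet> (closed_loop_weight Qd Rd K s *v x))"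
    "continuous_on {0..T} (\<lambda>s. (L s *v x) \<bullet> (Rd s *v (K s *v x)))"
    "continuous_on {0..T} (\<lambda>s. (L s *v x) \<bullet> (Rd s *v (L s *v x)))"
    by (intro continuous_intros Qd Rd K L(1))+
  have identity: "integral {0..T} (\<lambda>s. ((1 + primitive \<phi> s)\<^sup>2 - 1) * (x \<bullet> (closed_loop_weight Qd Rd K s *v x))
       + 2 * (1 + primitive \<phi> s) * \<phi> s * ((L s *v x) \<bullet> (Rd s *v (K s *v x)))
       + (\<phi> s)\<^sup>2 * ((L s *v x) \<bullet> (Rd s *v (L s *v x))))
     + ((1 + primitive \<phi> T)\<^sup>2 - 1) * (x \<bullet> (Gd *v x)) = 0"
    if "\<phi> \<in> vanishing_tests s0 T" "\<And>s. s \<in> {0..T} \<Longrightarrow> \<bar>primitive \<phi> s\<bar> < 1" for \<phi>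
    by (rule deviation_identity[OF K loop L s0 that])
  show "integral {0..T} (\<lambda>s. primitive \<phi> s * (x \<bullet> (closed_loop_weight Qd Rd K s *v x))
        + \<phi> s * ((L s *v x) \<bullet> (Rd s *v (K s *v x)))) + primitive \<phi> T * (x \<bullet> (Gd *v x)) = 0"
    if "\<phi> \<in> vanishing_tests s0 T" for \<phi>
    by (rule deviation_expansion(1)[OF _ s0(2) cont identity that]) (use s0 in auto)
  show "(L s *v x) \<bullet> (Rd s *v (L s *v x)) = 0" if "s \<in> {s0<..T}" for s
    by (rule deviation_expansion(2)[OF _ s0(2) cont identity that]) (use s0 in auto)
qed

text \<open>
  The base profiles \<open>K \<rho> Y = \<rho> Pr Y - L A\<close> all give the closed-loop matrix zero, because
  the projection \<open>Pr = I - L B\<close> maps onto the kernel of \<open>B\<close>. Every action is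
  \<open>u = L (B u) + Pr u\<close>, so it suffices that \<open>Rd\<close> vanishes on pairs from these two parts.
\<close>

lemma coefficients_agree:
  shows "\<And>s. s \<in> {0..T} \<Longrightarrow> Rd s = 0" and "\<And>s. s \<in> {0..T} \<Longrightarrow> Qd s = 0" and "Gd = 0"
proof -
  obtain L where L: "continuous_on {0..T} L" "\<And>s. s \<in> {0..T} \<Longrightarrow> B s ** L s = mat 1"
    "\<And>s c. own c \<noteq> i \<Longrightarrow> L s $ c = 0"
    by (rule block_right_inverse[OF B rank, of i]) (assumption, rule that)
  define Pr where "Pr s = mat 1 - L s ** B s" for s
  have Prc: "continuous_on {0..T} Pr" unfolding Pr_def by (intro continuous_intros L(1) B)
  have BPr: "B s ** Pr s = 0" if "s \<in> {0..T}" for s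
    using L(2)[OF that] by (simp add: Pr_def matrix_diff_left_distrib matrix_mul_assoc)
  define K where "K \<rho> Y s = \<rho> s *\<^sub>R (Pr s ** Y) - L s ** A s" for \<rho> Y s
  have Kc: "continuous_on {0..T} (K \<rho> Y)" if "continuous_on {0..T} \<rho>" for \<rho> Y
    unfolding K_def by (intro continuous_intros that Prc L(1) A)
  have loop: "A s + B s ** K \<rho> Y s = 0" if "s \<in> {0..T}" for \<rho> Y s
  proof -
    have "B s ** K \<rho> Y s = \<rho> s *\<^sub>R ((B s ** Pr s) ** Y) - (B s ** L s) ** A s"
      by (simp only: K_def matrix_diff_left_distrib matrix_mult_scaleR matrix_mul_assoc)
    then show ?thesis using L(2)[OF that] BPr[OF that] by (simp add: matrix_matrix_mult_def[of 0])
  qed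
  have variation: "integral {0..T} (\<lambda>s. primitive \<phi> s * (x \<bullet> (closed_loop_weight Qd Rd (K \<rho> Y) s *v x))
        + \<phi> s * ((L s *v x) \<bullet> (Rd s *v (K \<rho> Y s *v x)))) + primitive \<phi> T * (x \<bullet> (Gd *v x)) = 0"
    if "0 < s0" "s0 < T" "\<phi> \<in> vanishing_tests s0 T" "continuous_on {0..T} \<rho>" for s0 \<phi> \<rho> Y x
    by (rule first_variation(1)[OF Kc[OF that(4)] loop L that(1,2,3)])
  have forms: "(Pr s *v (Y *v x)) \<bullet> (Rd s *v (Pr s *v (Y *v x))) = 0"
      "(L s *v x) \<bullet> (Rd s *v (Pr s *v (Y *v x))) = 0"
      "(L s *v x) \<bullet> (Rd s *v (L s *v x)) = 0"
    if s: "s \<in> {0<..<T}" for s Y x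
  proof -
    \<comment> \<open>Half of the time up to \<open>s\<close> is left to player \<open>j\<close> for scaling the state.\<close>
    define s0 where "s0 = s / 2"
    have s0: "0 < s0" "s0 < T" "s \<in> {s0<..T}" using s by (auto simp: s0_def)
    define n k0 where "n s = Pr s *v (Y *v x)" and "k0 s = - (L s *v (A s *v x))" for s
    have nc: "continuous_on {0..T} n" and kc: "continuous_on {0..T} k0"
      unfolding n_def k0_def by (intro continuous_intros Prc L(1) A)+
    have Kx: "K \<rho> Y s *v x = \<rho> s *\<^sub>R n s + k0 s" for \<rho> s
      by (simp add: K_def n_def k0_def matrix_vector_mult_diff_rdistrib matrix_vector_mul_assoc
          flip: scaleR_matrix_vector_assoc)
    have lc: "continuous_on {0..T} (\<lambda>s. L s *v x)" by (intro continuous_intros L(1))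
    have identity: "integral {0..T} (\<lambda>s. primitive \<phi> s * ((x \<bullet> (Qd s *v x) + k0 s \<bullet> (Rd s *v k0 s))
          + 2 * \<rho> s * (n s \<bullet> (Rd s *v k0 s)) + (\<rho> s)\<^sup>2 * (n s \<bullet> (Rd s *v n s)))
        + \<phi> s * ((L s *v x) \<bullet> (Rd s *v k0 s) + \<rho> s * ((L s *v x) \<bullet> (Rd s *v n s))))
        + primitive \<phi> T * (x \<bullet> (Gd *v x)) = 0" (is "?I + _ = 0")
      if \<phi>: "\<phi> \<in> vanishing_tests s0 T" and \<rho>: "continuous_on {0..T} \<rho>" for \<phi> \<rho>
    proof -
      have "?I = integral {0..T} (\<lambda>s. primitive \<phi> s * (x \<bullet> (closed_loop_weight Qd Rd (K \<rho> Y) s *v x))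
        + \<phi> s * ((L s *v x) \<bullet> (Rd s *v (K \<rho> Y s *v x))))"
      proof (intro integral_cong)
        fix s assume s: "s \<in> {0..T}"
        have "x \<bullet> (closed_loop_weight Qd Rd (K \<rho> Y) s *v x) = (x \<bullet> (Qd s *v x) + k0 s \<bullet> (Rd s *v k0 s))
          + 2 * \<rho> s * (n s \<bullet> (Rd s *v k0 s)) + (\<rho> s)\<^sup>2 * (n s \<bullet> (Rd s *v n s))"
          using Rd_commute[OF s, of "k0 s" "n s"]
          by (simp add: closed_loop_weight_form Kx matrix_vector_right_distrib matrix_vector_mult_scaleR
              inner_add_left inner_add_right power2_eq_square distrib_left mult.assoc)
        moreover have "(L s *v x) \<bullet> (Rd s *v (K \<rho> Y s *v x))
            = (L s *v x) \<bullet> (Rd s *v k0 s) + \<rho> s * ((L s *v x) \<bullet> (Rd s *v n s))"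
          by (simp add: Kx matrix_vector_right_distrib matrix_vector_mult_scaleR inner_add_right)
        ultimately show "primitive \<phi> s * ((x \<bullet> (Qd s *v x) + k0 s \<bullet> (Rd s *v k0 s))
          + 2 * \<rho> s * (n s \<bullet> (Rd s *v k0 s)) + (\<rho> s)\<^sup>2 * (n s \<bullet> (Rd s *v n s)))
          + \<phi> s * ((L s *v x) \<bullet> (Rd s *v k0 s) + \<rho> s * ((L s *v x) \<bullet> (Rd s *v n s)))
          = primitive \<phi> s * (x \<bullet> (closed_loop_weight Qd Rd (K \<rho> Y) s *v x))
          + \<phi> s * ((L s *v x) \<bullet> (Rd s *v (K \<rho> Y s *v x)))" by simp
      qed
      then show ?thesis using variation[OF s0(1,2) \<phi> \<rho>, where Y = Y and x = x] by simp
    qed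
    have cont: "continuous_on {0..T} (\<lambda>s. x \<bullet> (Qd s *v x) + k0 s \<bullet> (Rd s *v k0 s))"
      "continuous_on {0..T} (\<lambda>s. (L s *v x) \<bullet> (Rd s *v k0 s))"
      "continuous_on {0..T} (\<lambda>s. n s \<bullet> (Rd s *v k0 s))"
      "continuous_on {0..T} (\<lambda>s. n s \<bullet> (Rd s *v n s))"
      "continuous_on {0..T} (\<lambda>s. (L s *v x) \<bullet> (Rd s *v n s))"
      by (intro continuous_intros Qd Rd nc kc lc)+
    show "(Pr s *v (Y *v x)) \<bullet> (Rd s *v (Pr s *v (Y *v x))) = 0"
      "(L s *v x) \<bullet> (Rd s *v (Pr s *v (Y *v x))) = 0"
      using first_order_expansion[OF less_imp_le[OF s0(1)] s0(2) cont identity s0(3)] by (simp_all add: n_def)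
    show "(L s *v x) \<bullet> (Rd s *v (L s *v x)) = 0"
      by (rule first_variation(2)[OF Kc[OF continuous_on_const] loop L s0])
  qed
  have R_open: "Rd s = 0" if s: "s \<in> {0<..<T}" for s
  proof (rule symmetric_form_zero)
    have sT: "s \<in> {0..T}" using s by auto
    show "transpose (Rd s) = Rd s"
      by (simp add: Rd_def transpose_diff R_sym[OF sT])
    fix u
    define q where "q = u - L s *v (B s *v u)"
    have "B s *v (L s *v (B s *v u)) = B s *v u"
      using L(2)[OF sT] by (simp add: matrix_vector_mul_assoc matrix_mul_assoc)
    then have "Pr s *v q = q"
      by (simp add: Pr_def q_def matrix_vector_mult_diff_rdistrib matrix_vector_mult_diff_distrib
          flip: matrix_vector_mul_assoc)
    then have q: "q \<bullet> (Rd s *v q) = 0" "x \<noteq> 0 \<Longrightarrow> (L s *v x) \<bullet> (Rd s *v q) = 0" for x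
    proof -
      show *: "(L s *v x) \<bullet> (Rd s *v q) = 0" if x: "x \<noteq> 0" for x
      proof -
        obtain Y :: "real^'n^'a" where "Y *v x = q" by (rule matrix_through_vector[OF x])
        then show ?thesis using forms(2)[OF s, of x Y] \<open>Pr s *v q = q\<close> by simp
      qed
      \<comment> \<open>The kernel part does not involve \<open>B u\<close>, so any nonzero vector can stand in when \<open>B u = 0\<close>.\<close>
      obtain Y :: "real^'n^'a" where "Y *v (1 :: real^'n) = q" by (rule matrix_through_vector[OF one_neq_zero])
      then show "q \<bullet> (Rd s *v q) = 0" using forms(1)[OF s, of Y 1] \<open>Pr s *v q = q\<close> by simp
    qed
    let ?l = "L s *v (B s *v u)"
    have "?l \<bullet> (Rd s *v q) = 0"
      using q(2)[of "B s *v u"] by (cases "B s *v u = 0") auto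
    then have "q \<bullet> (Rd s *v ?l) = 0" by (simp only: Rd_commute[OF sT, of q ?l])
    have "(?l + q) \<bullet> (Rd s *v (?l + q)) = ?l \<bullet> (Rd s *v ?l) + ?l \<bullet> (Rd s *v q)
        + q \<bullet> (Rd s *v ?l) + q \<bullet> (Rd s *v q)"
      by (simp only: matrix_vector_right_distrib inner_add_left inner_add_right add_ac)
    also have "\<dots> = 0"
      by (simp only: forms(3)[OF s] q(1) \<open>?l \<bullet> (Rd s *v q) = 0\<close> \<open>q \<bullet> (Rd s *v ?l) = 0\<close> add_0)
    also have "?l + q = u" by (simp add: q_def)
    finally show "u \<bullet> (Rd s *v u) = 0" .
  qed
  show R0: "Rd s = 0" if "s \<in> {0..T}" for s
    by (rule continuous_zero_closure[OF T Rd R_open that])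
  have QG: "x \<bullet> (Gd *v x) = 0" "s \<in> {s0<..<T} \<Longrightarrow> x \<bullet> (Qd s *v x) = 0"
    if s0: "0 < s0" "s0 < T" for s0 s x
  proof -
    have Qx: "continuous_on {0..T} (\<lambda>s. x \<bullet> (Qd s *v x))" by (intro continuous_intros Qd)
    have identity: "integral {0..T} (\<lambda>s. primitive \<phi> s * (x \<bullet> (Qd s *v x))) + primitive \<phi> T * (x \<bullet> (Gd *v x)) = 0"
      if \<phi>: "\<phi> \<in> vanishing_tests s0 T" for \<phi>
    proof -
      have "integral {0..T} (\<lambda>s. primitive \<phi> s * (x \<bullet> (closed_loop_weight Qd Rd (K (\<lambda>_. 0) 0) s *v x))
          + \<phi> s * ((L s *v x) \<bullet> (Rd s *v (K (\<lambda>_. 0) 0 s *v x))))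
        = integral {0..T} (\<lambda>s. primitive \<phi> s * (x \<bullet> (Qd s *v x)))"
        by (intro integral_cong) (simp add: closed_loop_weight_form R0)
      then show ?thesis
        using variation[where \<rho> = "\<lambda>_. 0", OF s0 \<phi> continuous_on_const, where Y = 0 and x = x] by simp
    qed
    show "x \<bullet> (Gd *v x) = 0" "s \<in> {s0<..<T} \<Longrightarrow> x \<bullet> (Qd s *v x) = 0"
      using weak_integral_zero[OF less_imp_le[OF s0(1)] s0(2) Qx identity] by auto
  qed
  show "Gd = 0"
    using QG(1)[of "T / 2"] T
    by (intro symmetric_form_zero) (auto simp: Gd_def transpose_diff G_sym)
  have Q_open: "Qd s = 0" if s: "s \<in> {0<..<T}" for s
    using QG(2)[of "s / 2" s] s Q_sym[of s]
    by (intro symmetric_form_zero) (auto simp: Qd_def transpose_diff)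
  show "Qd s = 0" if "s \<in> {0..T}" for s
    by (rule continuous_zero_closure[OF T Qd Q_open that])
qed

end

section \<open>The characterisation of potential games\<close>

theorem proposition4p8:
  fixes T :: real
    and own :: "'a::finite \<Rightarrow> 'i::finite"
    and A :: "real \<Rightarrow> real^'n^'n"
    and B :: "real \<Rightarrow> real^'a^'n"
    and \<sigma> :: "real^'m^'n"
    and Q :: "'i \<Rightarrow> real \<Rightarrow> real^'n^'n"
    and R :: "'i \<Rightarrow> real \<Rightarrow> real^'a^'a"
    and G :: "'i \<Rightarrow> real^'n^'n"
    and M :: "'w measure"
    and W :: "real \<Rightarrow> 'w \<Rightarrow> real^'m"
  assumes "T > 0"
    and "continuous_on {0..T} A"
    and "continuous_on {0..T} B"
    and "\<And>i. continuous_on {0..T} (Q i)"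
    and "\<And>i t. t \<in> {0..T} \<Longrightarrow> transpose (Q i t) = Q i t"
    and "\<And>i. continuous_on {0..T} (R i)"
    and "\<And>i t. t \<in> {0..T} \<Longrightarrow> transpose (R i t) = R i t"
    and "\<And>i. transpose (G i) = G i"
    and "standard_brownian_motion M T W"
    and "\<And>i t. t \<in> {0..T} \<Longrightarrow> full_row_rank (col_block own i (B t))"
  shows "markov_potential_game ({0..T} \<times> UNIV) (linear_policies own T)
           (lq_value M W T own A B \<sigma> Q R G)
         \<longleftrightarrow> (\<forall>i j. (\<forall>t\<in>{0..T}. Q i t = Q j t) \<and> (\<forall>t\<in>{0..T}. R i t = R j t) \<and> G i = G j)"
proof
  assume mpg: "markov_potential_game ({0..T} \<times> UNIV) (linear_policies own T)
           (lq_value M W T own A B \<sigma> Q R G)"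
  have "(\<forall>t\<in>{0..T}. Q i t = Q j t) \<and> (\<forall>t\<in>{0..T}. R i t = R j t) \<and> G i = G j" if "i \<noteq> j" for i j
  proof -
    interpret lq_potential_pair T own A B \<sigma> Q R G M W i j
      by unfold_locales (fact assms mpg that)+
    show ?thesis
      using coefficients_agree unfolding Qd_def Rd_def Gd_def by auto
  qed
  then show "\<forall>i j. (\<forall>t\<in>{0..T}. Q i t = Q j t) \<and> (\<forall>t\<in>{0..T}. R i t = R j t) \<and> G i = G j"
    by (metis (mono_tags))
next
  assume eq: "\<forall>i j. (\<forall>t\<in>{0..T}. Q i t = Q j t) \<and> (\<forall>t\<in>{0..T}. R i t = R j t) \<and> G i = G j"
  let ?V = "lq_value M W T own A B \<sigma> Q R G"
  have same: "?V i \<phi> z = ?V j \<phi> z" if z: "z \<in> {0..T} \<times> UNIV" for i j \<phi> z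
  proof -
    have G: "G i = G j" using eq by blast
    have QR: "Q i s = Q j s" "R i s = R j s" if "s \<in> {fst z..T}" for s
    proof -
      have "s \<in> {0..T}" using that z by (auto simp: mem_Times_iff)
      then show "Q i s = Q j s" "R i s = R j s" using eq by blast+
    qed
    have "integral {fst z..T} (\<lambda>s. X s \<bullet> (Q i s *v X s) + u s \<bullet> (R i s *v u s))
      = integral {fst z..T} (\<lambda>s. X s \<bullet> (Q j s *v X s) + u s \<bullet> (R j s *v u s))"
      for X :: "real \<Rightarrow> real^'n" and u :: "real \<Rightarrow> real^'a"
      by (intro integral_cong) (simp add: QR)
    then show ?thesis unfolding lq_value_def Let_def G by simp
  qed
  show "markov_potential_game ({0..T} \<times> UNIV) (linear_policies own T) ?V"
    unfolding markov_potential_game_def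
  proof (intro exI[of _ "\<lambda>z \<phi>. ?V undefined \<phi> z"] ballI allI impI)
    fix z i \<phi> p assume "z \<in> {0..T} \<times> (UNIV :: (real^'n) set)"
    then show "?V undefined (\<phi>(i := p)) z - ?V undefined \<phi> z = ?V i (\<phi>(i := p)) z - ?V i \<phi> z"
      using same[where i = undefined and j = i] by simp
  qed
qed

end
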